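(* Consider the problem of minimizing $J(x(\cdot))=\int_{t_0}^{t_1}L(t,x(t),\dot x(t))\,dt$ over $x(\cdot)\in KC^1(I,\mathbb R^n)$ with $x(t_0)=x_0$, $x(t_1)=x_1$. Let $L$ be continuously differentiable in the totality of variables, and let the partial derivatives $L_{xx},L_{x\dot x},L_{\dot x\dot x}$ and $L_{\dot x\dot x\dot x}$ be continuous in the totality of variables. Let the admissible function $\bar x(\cdot)$ be an extremal of this problem, and let $(\bar t_0,\bar t_1)\subset[t_0,t_1]$ be an interval containing no angular point of $\bar x(\cdot)$. For $\eta\in\mathbb R^n$ consider the degeneration condition $$E(\bar L)(t,\eta)=\eta^T\bar L_{\dot x\dot x}(t)\eta=0\quad\text{for all }t\in(\bar t_0,\bar t_1)\qquad(\mathrm D)$$ and the equality $$\eta^T\big(L_x(t,\bar x(t),\dot{\bar x}(t)+\eta)-\bar L_x(t)-\bar L_{x\dot x}(t)\eta\big)=0\quad\text{for all }t\in(\bar t_0,\bar t_1).\qquad(\mathrm C)$$ Then: (i) If $\bar x(\cdot)$ is a strong local minimum in the problem and (D) holds for a vector $\eta\ne0$, then (C) holds for this $\eta$. (ii) If $\bar x(\cdot)$ is a weak local minimum in the problem, then there exists a number $\delta>0$ such that for every $\eta\in B_\delta(0)$ satisfying (D), equality (C) is fulfilled.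
   Context: Setting. $(a,b)\subset\mathbb R$ is an interval, $I:=[t_0,t_1]\subset(a,b)$ with $t_0<t_1$, $x_0,x_1\in\mathbb R^n$, and $L=L(t,x,\dot x):(a,b)\times\mathbb R^n\times\mathbb R^n\to\mathbb R$; $L_x,L_{\dot x}$ are its partial gradients (column vectors) with respect to the second and third arguments, and $L_{xx},L_{x\dot x},L_{\dot x\dot x},L_{\dot x\dot x\dot x}$ the higher partial derivatives; $T$ denotes transposition; $B_\delta(0)$ is the closed ball of radius $\delta$ centered at $0\in\mathbb R^n$. $KC^1(I,\mathbb R^n)$ is the set of piecewise-smooth functions: continuous functions $x:I\to\mathbb R^n$ whose derivative is continuous on $I$ except at finitely many points of $(t_0,t_1)$ (angular points), where $\dot x$ has discontinuities of the first kind (finite one-sided limits); at $t_0$ and $t_1$ the right, respectively left, values of $\dot x$ are finite. A function $x(\cdot)\in KC^1(I,\mathbb R^n)$ with $x(t_0)=x_0$, $x(t_1)=x_1$ is called admissible. An admissible $\bar x(\cdot)$ is an extremal if it satisfies the Euler equation $\frac{d}{dt}L_{\dot x}(t,\bar x(t),\dot{\bar x}(t))=L_x(t,\bar x(t),\dot{\bar x}(t))$ at every $t\in I$ that is not an angular point of $\bar x$ (at $t_0$ and $t_1$ understood one-sidedly). An admissible $\bar x(\cdot)$ is a strong (weak) local minimum if there is $\bar\delta>0$ ($\hat\delta>0$) such that $J(x(\cdot))\ge J(\bar x(\cdot))$ for all admissible $x(\cdot)$ with $\|x(\cdot)-\bar x(\cdot)\|_{C(I,\mathbb R^n)}\le\bar\delta$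 (respectively $\max\{\|x(\cdot)-\bar x(\cdot)\|_{C(I,\mathbb R^n)},\|\dot x(\cdot)-\dot{\bar x}(\cdot)\|_{L_\infty(I,\mathbb R^n)}\}\le\hat\delta$). Notation along $\bar x(\cdot)$, for $\xi\in\mathbb R^n$: $\bar L(t)=L(t,\bar x(t),\dot{\bar x}(t))$, and similarly $\bar L_x(t),\bar L_{\dot x}(t),\bar L_{x\dot x}(t),\bar L_{\dot x\dot x}(t)$ are the partial derivatives evaluated at $(t,\bar x(t),\dot{\bar x}(t))$; $$E(\bar L)(t,\xi)=L(t,\bar x(t),\dot{\bar x}(t)+\xi)-\bar L(t)-\bar L_{\dot x}^T(t)\xi.$$ *)

theory Defs
  imports "HOL-Analysis.Analysis" "HOL-Probability.Essential_Supremum"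
begin

text \<open>
  A function on \<open>I = {t0..t1}\<close> is a total function of which only the values on \<open>I\<close> matter.
  Its derivative is taken within \<open>I\<close>: two-sided inside, one-sided at the endpoints.
  Where the derivative does not exist, \<open>velocity\<close> is an unspecified value.
\<close>

definition velocity :: "real \<Rightarrow> real \<Rightarrow> (real \<Rightarrow> 'a::real_normed_vector) \<Rightarrow> real \<Rightarrow> 'a" where
  "velocity t0 t1 x t = vector_derivative x (at t within {t0..t1})"

definition C1_point :: "real \<Rightarrow> real \<Rightarrow> (real \<Rightarrow> 'a::real_normed_vector) \<Rightarrow> real \<Rightarrow> bool" where
  "C1_point t0 t1 x t \<longleftrightarrow>
     x differentiable (at t within {t0..t1}) \<and>
     continuous (at t within {t0..t1}) (velocity t0 t1 x)"

definition angular_points :: "real \<Rightarrow> real \<Rightarrow> (real \<Rightarrow> 'a::real_normed_vector) \<Rightarrow> real set" where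
  "angular_points t0 t1 x = {t \<in> {t0<..<t1}. \<not> C1_point t0 t1 x t}"

definition KC1 :: "real \<Rightarrow> real \<Rightarrow> (real \<Rightarrow> 'a::real_normed_vector) set" where
  "KC1 t0 t1 = {x.
     continuous_on {t0..t1} x \<and>
     finite (angular_points t0 t1 x) \<and>
     C1_point t0 t1 x t0 \<and> C1_point t0 t1 x t1 \<and>
     (\<forall>s \<in> angular_points t0 t1 x.
        (\<exists>l. (velocity t0 t1 x \<longlongrightarrow> l) (at_left s)) \<and>
        (\<exists>r. (velocity t0 t1 x \<longlongrightarrow> r) (at_right s)))}"

definition admissible ::
  "real \<Rightarrow> real \<Rightarrow> 'a::real_normed_vector \<Rightarrow> 'a \<Rightarrow> (real \<Rightarrow> 'a) set" where
  "admissible t0 t1 x0 x1 = {x \<in> KC1 t0 t1. x t0 = x0 \<and> x t1 = x1}"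

definition functional_J ::
  "(real \<Rightarrow> 'a \<Rightarrow> 'a \<Rightarrow> real) \<Rightarrow> real \<Rightarrow> real \<Rightarrow> (real \<Rightarrow> 'a::real_normed_vector) \<Rightarrow> real" where
  "functional_J L t0 t1 x = integral {t0..t1} (\<lambda>t. L t (x t) (velocity t0 t1 x t))"

text \<open>
  In the next definition and in the theorem, \<open>Lx\<close> and \<open>Lv\<close> are the partial gradients of \<open>L\<close>
  with respect to the second and third arguments.
\<close>

definition extremal ::
  "(real \<Rightarrow> 'a \<Rightarrow> 'a \<Rightarrow> 'a) \<Rightarrow> (real \<Rightarrow> 'a \<Rightarrow> 'a \<Rightarrow> 'a) \<Rightarrow>
   real \<Rightarrow> real \<Rightarrow> 'a::real_normed_vector \<Rightarrow> 'a \<Rightarrow> (real \<Rightarrow> 'a) \<Rightarrow> bool" where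
  "extremal Lx Lv t0 t1 x0 x1 x \<longleftrightarrow>
     x \<in> admissible t0 t1 x0 x1 \<and>
     (\<forall>t \<in> {t0..t1} - angular_points t0 t1 x.
        ((\<lambda>s. Lv s (x s) (velocity t0 t1 x s)) has_vector_derivative
           Lx t (x t) (velocity t0 t1 x t)) (at t within {t0..t1}))"

definition C_norm :: "real \<Rightarrow> real \<Rightarrow> (real \<Rightarrow> 'a::real_normed_vector) \<Rightarrow> real" where
  "C_norm t0 t1 f = (SUP t\<in>{t0..t1}. norm (f t))"

definition Linf_norm :: "real \<Rightarrow> real \<Rightarrow> (real \<Rightarrow> 'a::real_normed_vector) \<Rightarrow> ereal" where
  "Linf_norm t0 t1 f = esssup (lebesgue_on {t0..t1}) (\<lambda>t. ereal (norm (f t)))"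

definition strong_local_min ::
  "(real \<Rightarrow> 'a \<Rightarrow> 'a \<Rightarrow> real) \<Rightarrow> real \<Rightarrow> real \<Rightarrow> 'a::real_normed_vector \<Rightarrow> 'a \<Rightarrow>
   (real \<Rightarrow> 'a) \<Rightarrow> bool" where
  "strong_local_min L t0 t1 x0 x1 xb \<longleftrightarrow>
     xb \<in> admissible t0 t1 x0 x1 \<and>
     (\<exists>\<delta>>0. \<forall>x \<in> admissible t0 t1 x0 x1.
        C_norm t0 t1 (\<lambda>t. x t - xb t) \<le> \<delta> \<longrightarrow>
        functional_J L t0 t1 x \<ge> functional_J L t0 t1 xb)"

definition weak_local_min ::
  "(real \<Rightarrow> 'a \<Rightarrow> 'a \<Rightarrow> real) \<Rightarrow> real \<Rightarrow> real \<Rightarrow> 'a::real_normed_vector \<Rightarrow> 'a \<Rightarrow>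
   (real \<Rightarrow> 'a) \<Rightarrow> bool" where
  "weak_local_min L t0 t1 x0 x1 xb \<longleftrightarrow>
     xb \<in> admissible t0 t1 x0 x1 \<and>
     (\<exists>\<delta>::real>0. \<forall>x \<in> admissible t0 t1 x0 x1.
        max (ereal (C_norm t0 t1 (\<lambda>t. x t - xb t)))
            (Linf_norm t0 t1 (\<lambda>t. velocity t0 t1 x t - velocity t0 t1 xb t)) \<le> ereal \<delta> \<longrightarrow>
        functional_J L t0 t1 x \<ge> functional_J L t0 t1 xb)"

definition excess ::
  "(real \<Rightarrow> 'a \<Rightarrow> 'a \<Rightarrow> real) \<Rightarrow> (real \<Rightarrow> 'a \<Rightarrow> 'a \<Rightarrow> 'a) \<Rightarrow> real \<Rightarrow> real \<Rightarrow>
   (real \<Rightarrow> 'a::real_inner) \<Rightarrow> real \<Rightarrow> 'a \<Rightarrow> real" where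
  "excess L Lv t0 t1 xb t \<xi> =
     L t (xb t) (velocity t0 t1 xb t + \<xi>) - L t (xb t) (velocity t0 t1 xb t)
       - Lv t (xb t) (velocity t0 t1 xb t) \<bullet> \<xi>"

definition condition_D ::
  "(real \<Rightarrow> real^'n \<Rightarrow> real^'n \<Rightarrow> real) \<Rightarrow> (real \<Rightarrow> real^'n \<Rightarrow> real^'n \<Rightarrow> real^'n) \<Rightarrow>
   (real \<Rightarrow> real^'n \<Rightarrow> real^'n \<Rightarrow> real^'n^'n) \<Rightarrow> real \<Rightarrow> real \<Rightarrow> (real \<Rightarrow> real^'n) \<Rightarrow>
   real set \<Rightarrow> real^'n \<Rightarrow> bool" where
  "condition_D L Lv Lvv t0 t1 xb S \<eta> \<longleftrightarrow>
     (\<forall>t\<in>S. excess L Lv t0 t1 xb t \<eta> = 0 \<and>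
             \<eta> \<bullet> (Lvv t (xb t) (velocity t0 t1 xb t) *v \<eta>) = 0)"

definition condition_C ::
  "(real \<Rightarrow> real^'n \<Rightarrow> real^'n \<Rightarrow> real^'n) \<Rightarrow> (real \<Rightarrow> real^'n \<Rightarrow> real^'n \<Rightarrow> real^'n^'n) \<Rightarrow>
   real \<Rightarrow> real \<Rightarrow> (real \<Rightarrow> real^'n) \<Rightarrow> real set \<Rightarrow> real^'n \<Rightarrow> bool" where
  "condition_C Lx Lxv t0 t1 xb S \<eta> \<longleftrightarrow>
     (\<forall>t\<in>S. \<eta> \<bullet> (Lx t (xb t) (velocity t0 t1 xb t + \<eta>) - Lx t (xb t) (velocity t0 t1 xb t)
                  - Lxv t (xb t) (velocity t0 t1 xb t) *v \<eta>) = 0)"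

end

theory Submission
  imports Defs
begin

text \<open>
  For a point \<open>\<theta>\<close> of the interval and small \<open>\<beta> > 0\<close>, perturb \<open>xb\<close> by a tent \<open>h\<close> in the direction
  \<open>\<eta>\<close> that has velocity \<open>\<eta>\<close> on an interval of length \<open>\<beta>\<^sup>3\<close> and returns to zero with velocity
  \<open>- \<beta>\<^sup>2 \<eta>\<close> on an adjacent interval of length \<open>\<beta>\<close>. By the Euler equation the first-order part of the
  increment of the functional integrates to zero, and by (D) the excess vanishes on the first
  interval and is \<open>O(\<beta>\<^sup>6)\<close> on the second, contributing only \<open>O(\<beta>\<^sup>7)\<close>. What remains is
  \<open>\<plusminus> \<beta>\<^sup>6 / 2\<close> times the expression in (C) at \<open>\<theta>\<close>, up to \<open>o(\<beta>\<^sup>6)\<close>: plus if the tent starts at \<open>\<theta>\<close>,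
  minus if it ends there. Minimality makes both signs nonnegative. Since \<open>\<parallel>h\<parallel> \<le> \<beta>\<^sup>3 \<parallel>\<eta>\<parallel>\<close> and
  \<open>\<parallel>h'\<parallel> \<le> \<parallel>\<eta>\<parallel>\<close>, a strong minimum admits every \<open>\<eta>\<close> and a weak one every small \<open>\<eta>\<close>.
\<close>

subsection \<open>Piecewise smooth functions\<close>


lemma velocity_eqI:
  assumes "t0 < t1" "t \<in> {t0..t1}" "(x has_vector_derivative v) (at t within {t0..t1})"
  shows "velocity t0 t1 x t = v"
  unfolding velocity_def using vector_derivative_within_cbox[of t0 t1 t x v] assms by auto

lemma C1_point_has_velocity:
  assumes "C1_point t0 t1 x t"
  shows "(x has_vector_derivative velocity t0 t1 x t) (at t within {t0..t1})"
  using assms unfolding C1_point_def velocity_def by (simp add: vector_derivative_works)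

lemma KC1_C1_point:
  assumes "x \<in> KC1 t0 t1" "t \<in> {t0..t1}" "t \<notin> angular_points t0 t1 x"
  shows "C1_point t0 t1 x t"
  using assms unfolding KC1_def angular_points_def
  by (cases "t = t0 \<or> t = t1") auto

lemma at_one_sided_le_within:
  fixes s :: real assumes "s \<in> {t0<..<t1}"
  shows "at_left s \<le> at s within {t0..t1}" "at_right s \<le> at s within {t0..t1}"
proof -
  have "at s within {t0..t1} = at s" using assms by (intro at_within_interior) simp
  then show "at_left s \<le> at s within {t0..t1}" "at_right s \<le> at s within {t0..t1}"
    by (auto intro: at_le)
qed

text \<open>One-sided limits are required in \<open>KC1\<close> only at angular points; at every
  other interior point they come from continuity of the velocity.\<close>

lemma KC1_limits:
  assumes "x \<in> KC1 t0 t1" "s \<in> {t0<..<t1}"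
  shows "\<exists>l. (velocity t0 t1 x \<longlongrightarrow> l) (at_left s)" "\<exists>r. (velocity t0 t1 x \<longlongrightarrow> r) (at_right s)"
proof -
  have *: "(velocity t0 t1 x \<longlongrightarrow> velocity t0 t1 x s) (at s within {t0..t1})"
    if "s \<notin> angular_points t0 t1 x"
    using KC1_C1_point[OF assms(1) _ that] assms(2) by (auto simp: C1_point_def continuous_within)
  show "\<exists>l. (velocity t0 t1 x \<longlongrightarrow> l) (at_left s)"
    using * assms tendsto_mono[OF at_one_sided_le_within(1)[OF assms(2)]] by (fastforce simp: KC1_def)
  show "\<exists>r. (velocity t0 t1 x \<longlongrightarrow> r) (at_right s)"
    using * assms tendsto_mono[OF at_one_sided_le_within(2)[OF assms(2)]] by (fastforce simp: KC1_def)
qed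

text \<open>The angular points other than \<open>t\<close> form a finite, hence closed, set, so a
  punctured neighbourhood of \<open>t\<close> avoids them. The point \<open>t\<close> may itself be
  angular.\<close>

lemma KC1_eventually_C1:
  assumes "x \<in> KC1 t0 t1"
  shows "eventually (\<lambda>s. C1_point t0 t1 x s) (at t within {t0..t1})"
proof -
  have "finite (angular_points t0 t1 x - {t})" using assms by (auto simp: KC1_def)
  then have "open (- (angular_points t0 t1 x - {t}))" by (intro open_Compl finite_imp_closed)
  then have "eventually (\<lambda>s. s \<in> - (angular_points t0 t1 x - {t})) (at t within {t0..t1})"
    by (auto intro!: eventually_at_in_open' eventually_at_topological[THEN iffD2])
  moreover have "eventually (\<lambda>s. s \<in> {t0..t1} \<and> s \<noteq> t) (at t within {t0..t1})"
    by (auto simp: eventually_at_filter)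
  ultimately show ?thesis
    by eventually_elim (use KC1_C1_point[OF assms] in auto)
qed

lemma velocity_add:
  assumes "t0 < t1" "t \<in> {t0..t1}" "C1_point t0 t1 x t" "C1_point t0 t1 y t"
  shows "velocity t0 t1 (\<lambda>s. x s + y s) t = velocity t0 t1 x t + velocity t0 t1 y t"
  by (intro velocity_eqI assms has_vector_derivative_add C1_point_has_velocity)

text \<open>Velocities are unspecified where the derivative fails to exist, so additivity can fail
  at angular points. Limits see only nearby points, and there it holds.\<close>

lemma KC1_eventually_velocity_add:
  assumes "t0 < t1" "x \<in> KC1 t0 t1" "y \<in> KC1 t0 t1"
  shows "eventually (\<lambda>s. velocity t0 t1 x s + velocity t0 t1 y s = velocity t0 t1 (\<lambda>s. x s + y s) s)
           (at t within {t0..t1})"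
proof -
  have "eventually (\<lambda>s. s \<in> {t0..t1}) (at t within {t0..t1})" by (auto simp: eventually_at_filter)
  with KC1_eventually_C1[OF assms(2)] KC1_eventually_C1[OF assms(3)] show ?thesis
    by eventually_elim (rule velocity_add[OF assms(1), symmetric])
qed

lemma C1_point_add:
  assumes "t0 < t1" "x \<in> KC1 t0 t1" "y \<in> KC1 t0 t1" "t \<in> {t0..t1}"
    "C1_point t0 t1 x t" "C1_point t0 t1 y t"
  shows "C1_point t0 t1 (\<lambda>s. x s + y s) t"
proof -
  have "((\<lambda>s. velocity t0 t1 x s + velocity t0 t1 y s) \<longlongrightarrow> velocity t0 t1 x t + velocity t0 t1 y t)
          (at t within {t0..t1})"
    using assms(5,6) by (intro tendsto_add) (auto simp: C1_point_def continuous_within)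
  then have "(velocity t0 t1 (\<lambda>s. x s + y s) \<longlongrightarrow> velocity t0 t1 x t + velocity t0 t1 y t)
          (at t within {t0..t1})"
    by (rule Lim_transform_eventually) (rule KC1_eventually_velocity_add[OF assms(1-3)])
  then show ?thesis using assms velocity_add[OF assms(1,4-6)]
    by (auto simp: C1_point_def continuous_within intro!: differentiable_add)
qed

text \<open>Used twice: to assemble a tent from ramps, and to see that \<open>xb\<close> plus a tent
  is again piecewise smooth.\<close>

lemma KC1_add:
  assumes "t0 < t1" "x \<in> KC1 t0 t1" "y \<in> KC1 t0 t1"
  shows "(\<lambda>s. x s + y s) \<in> KC1 t0 t1"
proof -
  have sub: "angular_points t0 t1 (\<lambda>s. x s + y s) \<subseteq> angular_points t0 t1 x \<union> angular_points t0 t1 y"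
    using C1_point_add[OF assms] by (auto simp: angular_points_def)
  have lim: "(\<exists>l. (velocity t0 t1 (\<lambda>s. x s + y s) \<longlongrightarrow> l) F)"
    if "F \<le> at s within {t0..t1}" "\<exists>l. (velocity t0 t1 x \<longlongrightarrow> l) F" "\<exists>l. (velocity t0 t1 y \<longlongrightarrow> l) F" for F s
  proof -
    from that obtain l k where "(velocity t0 t1 x \<longlongrightarrow> l) F" "(velocity t0 t1 y \<longlongrightarrow> k) F" by auto
    then have "((\<lambda>s. velocity t0 t1 x s + velocity t0 t1 y s) \<longlongrightarrow> l + k) F" by (rule tendsto_add)
    then show ?thesis
      using Lim_transform_eventually filter_leD[OF that(1) KC1_eventually_velocity_add[OF assms]]
      by blast
  qed
  show ?thesis unfolding KC1_def
  proof (intro CollectI conjI ballI)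
    show "finite (angular_points t0 t1 (\<lambda>s. x s + y s))"
      using sub assms(2,3) by (auto simp: KC1_def intro: finite_subset)
    show "continuous_on {t0..t1} (\<lambda>s. x s + y s)"
      using assms(2,3) by (auto simp: KC1_def intro: continuous_on_add)
    show "C1_point t0 t1 (\<lambda>s. x s + y s) t0" "C1_point t0 t1 (\<lambda>s. x s + y s) t1"
      using assms by (auto intro!: C1_point_add[OF assms] simp: KC1_def)
    fix s assume "s \<in> angular_points t0 t1 (\<lambda>s. x s + y s)"
    then have s: "s \<in> {t0<..<t1}" by (simp add: angular_points_def)
    show "\<exists>l. (velocity t0 t1 (\<lambda>s. x s + y s) \<longlongrightarrow> l) (at_left s)"
      by (rule lim[OF at_one_sided_le_within(1)[OF s] KC1_limits(1)[OF assms(2) s] KC1_limits(1)[OF assms(3) s]])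
    show "\<exists>l. (velocity t0 t1 (\<lambda>s. x s + y s) \<longlongrightarrow> l) (at_right s)"
      by (rule lim[OF at_one_sided_le_within(2)[OF s] KC1_limits(2)[OF assms(2) s] KC1_limits(2)[OF assms(3) s]])
  qed
qed

section \<open>Ramps, the building blocks of the variations\<close>

lemma ramp_has_vector_derivative:
  fixes \<eta> :: "'a::real_normed_vector"
  assumes "t \<noteq> c"
  shows "((\<lambda>s. max 0 (s - c) *\<^sub>R \<eta>) has_vector_derivative (if t < c then 0 else \<eta>)) (at t within A)"
proof (cases "t < c")
  case True
  have "((\<lambda>s. 0) has_vector_derivative 0) (at t)" by simp
  then have "((\<lambda>s. max 0 (s - c) *\<^sub>R \<eta>) has_vector_derivative 0) (at t)"
    by (rule has_vector_derivative_transform_within_open[where S="{..<c}"]) (use True in auto)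
  then show ?thesis using True by (auto intro: has_vector_derivative_at_within)
next
  case False
  have "((\<lambda>s. (s - c) *\<^sub>R \<eta>) has_vector_derivative \<eta>) (at t)"
    by (auto intro!: derivative_eq_intros)
  then have "((\<lambda>s. max 0 (s - c) *\<^sub>R \<eta>) has_vector_derivative \<eta>) (at t)"
    by (rule has_vector_derivative_transform_within_open[where S="{c<..}"]) (use False assms in auto)
  then show ?thesis using False by (auto intro: has_vector_derivative_at_within)
qed

lemma velocity_ramp:
  fixes \<eta> :: "'a::real_normed_vector"
  assumes "t0 < t1" "t \<in> {t0..t1}" "t \<noteq> c"
  shows "velocity t0 t1 (\<lambda>s. max 0 (s - c) *\<^sub>R \<eta>) t = (if t < c then 0 else \<eta>)"
  by (intro velocity_eqI ramp_has_vector_derivative assms)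

text \<open>Off the kink the velocity is locally constant, hence continuous.\<close>

lemma C1_point_ramp:
  fixes \<eta> :: "'a::real_normed_vector"
  assumes "t0 < t1" "t \<in> {t0..t1}" "t \<noteq> c"
  shows "C1_point t0 t1 (\<lambda>s. max 0 (s - c) *\<^sub>R \<eta>) t"
proof -
  let ?x = "\<lambda>s. max 0 (s - c) *\<^sub>R \<eta>"
  have "eventually (\<lambda>s. s \<in> (if t < c then {..<c} else {c<..})) (at t within {t0..t1})"
    using assms(3) by (intro filter_leD[OF at_le[OF subset_UNIV] eventually_at_in_open']) auto
  moreover have "eventually (\<lambda>s. s \<in> {t0..t1}) (at t within {t0..t1})"
    by (auto simp: eventually_at_filter)
  ultimately have "eventually (\<lambda>s. velocity t0 t1 ?x t = velocity t0 t1 ?x s) (at t within {t0..t1})"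
    by eventually_elim (use assms in \<open>auto simp: velocity_ramp split: if_splits\<close>)
  then have "(velocity t0 t1 ?x \<longlongrightarrow> velocity t0 t1 ?x t) (at t within {t0..t1})"
    by (rule Lim_transform_eventually[OF tendsto_const])
  then show ?thesis
    using ramp_has_vector_derivative[OF assms(3)]
    by (auto simp: C1_point_def continuous_within intro: differentiableI_vector)
qed

lemma KC1_ramp:
  fixes \<eta> :: "'a::real_normed_vector"
  assumes "t0 < c" "c < t1"
  shows "(\<lambda>s. max 0 (s - c) *\<^sub>R \<eta>) \<in> KC1 t0 t1"
proof -
  let ?x = "\<lambda>s. max 0 (s - c) *\<^sub>R \<eta>"
  have t: "t0 < t1" using assms by simp
  have sub: "angular_points t0 t1 ?x \<subseteq> {c}"
  proof
    fix s assume "s \<in> angular_points t0 t1 ?x"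
    then show "s \<in> {c}" using C1_point_ramp[OF t, of s c \<eta>] by (auto simp: angular_points_def)
  qed
  have "eventually (\<lambda>s. 0 = velocity t0 t1 ?x s) (at_left c)"
    using eventually_at_left_real[OF assms(1)] 
    by eventually_elim (use assms in \<open>auto simp: velocity_ramp\<close>)
  then have l: "(velocity t0 t1 ?x \<longlongrightarrow> 0) (at_left c)"
    by (rule Lim_transform_eventually[OF tendsto_const])
  have "eventually (\<lambda>s. \<eta> = velocity t0 t1 ?x s) (at_right c)"
    using eventually_at_right_real[OF assms(2)] 
    by eventually_elim (use assms in \<open>auto simp: velocity_ramp\<close>)
  then have r: "(velocity t0 t1 ?x \<longlongrightarrow> \<eta>) (at_right c)"
    by (rule Lim_transform_eventually[OF tendsto_const])
  show ?thesis unfolding KC1_def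
  proof (intro CollectI conjI ballI)
    show "finite (angular_points t0 t1 ?x)" using sub by (rule finite_subset) simp
    show "continuous_on {t0..t1} ?x" by (intro continuous_intros)
    show "C1_point t0 t1 ?x t0" "C1_point t0 t1 ?x t1"
      using assms by (auto intro!: C1_point_ramp)
  qed (use sub l r in blast)+
qed

section \<open>Bounded velocities and integrability of the Lagrangian\<close>

text \<open>Convergence of the velocity, two-sided or from each side, bounds it near every point;
  compactness of the interval turns the local bounds into a global one.\<close>

lemma velocity_bounded:
  assumes "x \<in> KC1 t0 t1"
  shows "bounded (velocity t0 t1 x ` {t0..t1})"
proof -
  let ?v = "velocity t0 t1 x"
  have nb: "\<exists>B. eventually (\<lambda>t. norm (?v t) \<le> B) F" if "(?v \<longlongrightarrow> l) F" for F l
  proof -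
    have "eventually (\<lambda>t. norm (?v t) < norm l + 1) F"
      using order_tendstoD(2)[OF tendsto_norm[OF that], of "norm l + 1"] by simp
    then show ?thesis by (intro exI[of _ "norm l + 1"]) (auto elim: eventually_mono)
  qed
  let ?C = "{U. open U \<and> bounded (?v ` (U \<inter> {t0..t1}))}"
  have ex: "\<exists>U\<in>?C. s \<in> U" if s: "s \<in> {t0..t1}" for s
  proof -
    have "\<exists>B. eventually (\<lambda>t. norm (?v t) \<le> B) (at s within {t0..t1})"
    proof (cases "C1_point t0 t1 x s")
      case True
      then have "(?v \<longlongrightarrow> ?v s) (at s within {t0..t1})"
        by (simp add: C1_point_def continuous_within)
      then show ?thesis by (rule nb)
    next
      case False
      then have "s \<in> angular_points t0 t1 x" using KC1_C1_point[OF assms s] by blast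
      then have s': "s \<in> {t0<..<t1}" by (simp add: angular_points_def)
      obtain l r where lr: "(?v \<longlongrightarrow> l) (at_left s)" "(?v \<longlongrightarrow> r) (at_right s)"
        using KC1_limits[OF assms s'] by blast
      obtain B1 where B1: "eventually (\<lambda>t. norm (?v t) \<le> B1) (at_left s)"
        using nb[OF lr(1)] ..
      obtain B2 where B2: "eventually (\<lambda>t. norm (?v t) \<le> B2) (at_right s)"
        using nb[OF lr(2)] ..
      have "eventually (\<lambda>t. norm (?v t) \<le> max B1 B2) (at s)"
        unfolding eventually_at_split
      proof
        show "eventually (\<lambda>t. norm (?v t) \<le> max B1 B2) (at_left s)"
          using B1 by eventually_elim simp
        show "eventually (\<lambda>t. norm (?v t) \<le> max B1 B2) (at_right s)"
          using B2 by eventually_elim simp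
      qed
      then have "eventually (\<lambda>t. norm (?v t) \<le> max B1 B2) (at s within {t0..t1})"
        by (rule filter_leD[OF at_le[OF subset_UNIV]])
      then show ?thesis ..
    qed
    then obtain B where "eventually (\<lambda>t. norm (?v t) \<le> B) (at s within {t0..t1})" ..
    then obtain U where U: "open U" "s \<in> U"
        "\<forall>t\<in>U. t \<noteq> s \<longrightarrow> t \<in> {t0..t1} \<longrightarrow> norm (?v t) \<le> B"
      unfolding eventually_at_topological by blast
    \<comment> \<open>The filter says nothing about \<open>s\<close> itself, where the velocity may
      be an unspecified value, so its norm enters the bound separately.\<close>
    have "norm (?v t) \<le> max B (norm (?v s))" if "t \<in> U \<inter> {t0..t1}" for t
      using U(3) that by (cases "t = s") (simp_all add: le_max_iff_disj)
    then have "bounded (?v ` (U \<inter> {t0..t1}))" unfolding bounded_iff by blast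
    with U show ?thesis by blast
  qed
  obtain D where D: "D \<subseteq> ?C" "finite D" "{t0..t1} \<subseteq> \<Union> D"
  proof (rule compactE[of "{t0..t1}" ?C])
    show "{t0..t1} \<subseteq> \<Union> ?C" using ex by blast
  qed auto
  have "bounded (\<Union>U\<in>D. ?v ` (U \<inter> {t0..t1}))"
    using D(1,2) by (intro bounded_UN) auto
  then show ?thesis by (rule bounded_subset) (use D(3) in blast)
qed

lemma KC1_velocity_continuous_on:
  assumes "x \<in> KC1 t0 t1" "A \<subseteq> {t0..t1}" "A \<inter> angular_points t0 t1 x = {}"
  shows "continuous_on A (velocity t0 t1 x)"
  unfolding continuous_on_eq_continuous_within
proof
  fix t assume "t \<in> A"
  then have "C1_point t0 t1 x t" using assms by (intro KC1_C1_point) auto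
  then show "continuous (at t within A) (velocity t0 t1 x)"
    using assms(2) continuous_within_subset by (auto simp: C1_point_def)
qed

text \<open>The integrand is continuous off the finitely many angular points and bounded, which
  suffices. Integrability guarantees that \<open>functional_J\<close> is a genuine integral and not
  the default value of \<open>integral\<close>.\<close>

lemma Lagrangian_integrable:
  fixes L :: "real \<Rightarrow> 'a::euclidean_space \<Rightarrow> 'a \<Rightarrow> real"
  assumes "t0 < t1" "x \<in> KC1 t0 t1"
    and L: "continuous_on ({t0..t1} \<times> UNIV \<times> UNIV) (\<lambda>(t, x, v). L t x v)"
  shows "(\<lambda>t. L t (x t) (velocity t0 t1 x t)) integrable_on {t0..t1}"
proof -
  let ?f = "\<lambda>t. L t (x t) (velocity t0 t1 x t)"
  let ?F = "angular_points t0 t1 x"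
  have fin: "finite ?F" and xc: "continuous_on {t0..t1} x" using assms(2) by (auto simp: KC1_def)
  obtain B where B: "\<And>t. t \<in> {t0..t1} \<Longrightarrow> norm (velocity t0 t1 x t) \<le> B"
    using velocity_bounded[OF assms(2)] unfolding bounded_iff by blast
  \<comment> \<open>A compact set containing every argument triple along \<open>x\<close>;
    continuity of \<open>L\<close> on it gives the bound \<open>C\<close>.\<close>
  let ?K = "{t0..t1} \<times> x ` {t0..t1} \<times> cball (0::'a) B"
  have "compact ?K" using xc by (intro compact_Times compact_continuous_image) auto
  moreover have "continuous_on ?K (\<lambda>(t, x, v). L t x v)" using L by (rule continuous_on_subset) auto
  ultimately have "bounded ((\<lambda>(t, x, v). L t x v) ` ?K)"
    by (intro compact_imp_bounded compact_continuous_image)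
  then obtain C where "\<forall>p\<in>?K. \<bar>case p of (t, x, v) \<Rightarrow> L t x v\<bar> \<le> C"
    unfolding bounded_iff by auto
  moreover have "(t, x t, velocity t0 t1 x t) \<in> ?K" if "t \<in> {t0..t1}" for t
    using B that by simp
  ultimately have C: "\<bar>?f t\<bar> \<le> C" if "t \<in> {t0..t1}" for t
    using that by fastforce
  have cont: "continuous_on ({t0..t1} - ?F) ?f"
  proof -
    have "continuous_on ({t0..t1} - ?F) ((\<lambda>(t, x, v). L t x v) \<circ> (\<lambda>t. (t, x t, velocity t0 t1 x t)))"
      by (intro continuous_on_compose continuous_intros continuous_on_subset[OF xc]
          KC1_velocity_continuous_on[OF assms(2)] continuous_on_subset[OF L]) auto
    then show ?thesis by (simp add: o_def)
  qed
  have meas: "{t0..t1} - ?F \<in> sets lebesgue"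
    using negligible_imp_sets[OF negligible_finite[OF fin]] by (intro sets.Diff) simp_all
  have "?f integrable_on ({t0..t1} - ?F)"
  proof (rule measurable_bounded_by_integrable_imp_integrable_real)
    show "?f \<in> borel_measurable (lebesgue_on ({t0..t1} - ?F))"
      using cont meas by (rule continuous_imp_measurable_on_sets_lebesgue)
    show "(\<lambda>_. C) integrable_on ({t0..t1} - ?F)"
      by (rule integrable_spike_set[OF integrable_const_ivl]; rule negligible_subset[OF negligible_finite[OF fin]]) auto
    show "\<bar>?f t\<bar> \<le> C" if "t \<in> {t0..t1} - ?F" for t using C that by blast
  qed (rule meas)
  then show ?thesis
    by (rule integrable_spike_set; intro negligible_subset[OF negligible_finite[OF fin]]) auto
qed

subsection \<open>Local estimates for the Lagrangian\<close>

text \<open>Continuity at one point with a separate closeness condition for each argument. The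
  domain is open, so the same radius also keeps \<open>t\<close> inside the interval.\<close>

lemma continuous_on_near:
  fixes f :: "real \<Rightarrow> 'b::metric_space \<Rightarrow> 'b \<Rightarrow> 'c::metric_space"
  assumes "continuous_on ({a<..<b} \<times> UNIV \<times> UNIV) (\<lambda>(t, x, v). f t x v)" "\<theta> \<in> {a<..<b}" "e > 0"
  obtains d where "d > 0" "\<And>t x v. \<bar>t - \<theta>\<bar> < d \<Longrightarrow> dist x x0 < d \<Longrightarrow> dist v v0 < d \<Longrightarrow>
      t \<in> {a<..<b} \<and> dist (f t x v) (f \<theta> x0 v0) < e"
proof -
  let ?S = "{a<..<b} \<times> (UNIV :: 'b set) \<times> (UNIV :: 'b set)" and ?p = "(\<theta>, x0, v0)"
  have S: "open ?S" "?p \<in> ?S" using assms(2) by (auto intro!: open_Times)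
  then have "isCont (\<lambda>(t, x, v). f t x v) ?p"
    using assms(1) by (simp add: continuous_on_eq_continuous_at)
  then have "((\<lambda>(t, x, v). f t x v) \<longlongrightarrow> f \<theta> x0 v0) (nhds ?p)"
    by (simp add: continuous_within tendsto_nhds_iff)
  then have "eventually (\<lambda>p. dist ((\<lambda>(t, x, v). f t x v) p) (f \<theta> x0 v0) < e) (nhds ?p)"
    using assms(3) by (rule tendstoD)
  moreover have "eventually (\<lambda>p. p \<in> ?S) (nhds ?p)" using S by (rule eventually_nhds_in_open)
  ultimately have "eventually (\<lambda>p. p \<in> ?S \<and> dist ((\<lambda>(t, x, v). f t x v) p) (f \<theta> x0 v0) < e) (nhds ?p)"
    by eventually_elim simp
  then obtain D where D: "D > 0"
    "\<And>p. dist p ?p < D \<Longrightarrow> p \<in> ?S \<and> dist ((\<lambda>(t, x, v). f t x v) p) (f \<theta> x0 v0) < e"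
    unfolding eventually_nhds_metric by blast
  show ?thesis
  proof (rule that)
    \<comment> \<open>The distance in the product is at most the sum of the three component
      distances.\<close>
    show "D / 3 > 0" using D(1) by simp
    fix t x v assume *: "\<bar>t - \<theta>\<bar> < D / 3" "dist x x0 < D / 3" "dist v v0 < D / 3"
    have "dist (t, x, v) ?p \<le> dist t \<theta> + dist (x, v) (x0, v0)"
      unfolding dist_Pair_Pair[of t] by (rule sqrt_sum_squares_le_sum) auto
    also have "dist (x, v) (x0, v0) \<le> dist x x0 + dist v v0"
      unfolding dist_Pair_Pair by (rule sqrt_sum_squares_le_sum) auto
    finally have "dist (t, x, v) ?p < D" using * by (simp add: dist_real_def)
    from D(2)[OF this] show "t \<in> {a<..<b} \<and> dist (f t x v) (f \<theta> x0 v0) < e" by simp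
  qed
qed

text \<open>Mean value bound on the symmetric interval, so that \<open>k\<close> may have either
  sign.\<close>

lemma real_lipschitz_bound:
  fixes f :: "real \<Rightarrow> real"
  assumes "\<And>s. \<bar>s\<bar> \<le> \<bar>k\<bar> \<Longrightarrow> (f has_real_derivative f' s) (at s)"
    and "\<And>s. \<bar>s\<bar> \<le> \<bar>k\<bar> \<Longrightarrow> \<bar>f' s\<bar> \<le> B"
  shows "\<bar>f k - f 0\<bar> \<le> B * \<bar>k\<bar>"
proof -
  have "norm (f k - f 0) \<le> B * norm (k - 0)"
  proof (rule field_differentiable_bound[of "{-\<bar>k\<bar>..\<bar>k\<bar>}" f f'])
    fix s assume "s \<in> {-\<bar>k\<bar>..\<bar>k\<bar>}"
    then have s: "\<bar>s\<bar> \<le> \<bar>k\<bar>" by (simp add: abs_le_iff)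
    show "(f has_real_derivative f' s) (at s within {-\<bar>k\<bar>..\<bar>k\<bar>})"
      using assms(1)[OF s] by (rule DERIV_subset) simp
    show "norm (f' s) \<le> B" using assms(2)[OF s] by simp
  qed auto
  then show ?thesis by simp
qed

text \<open>Linearity in the matrix transfers differentiability and continuity from the matrices of
  second derivatives to their quadratic forms.\<close>

lemma bounded_linear_quadratic_form: "bounded_linear (\<lambda>A::real^'n^'n. \<eta> \<bullet> (A *v \<eta>))"
  by (intro linear_conv_bounded_linear[THEN iffD1] linearI)
    (simp_all add: matrix_vector_mult_add_rdistrib inner_add_right scaleR_matrix_vector_assoc[symmetric])

lemma obtain_small_multiple:
  fixes c :: real
  assumes "0 < e"
  obtains d where "d > 0" "d * c < e"
proof
  show "e / (2 * (1 + \<bar>c\<bar>)) > 0" using assms by simp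
  have "e * c < e * (2 * (1 + \<bar>c\<bar>))" using assms by (intro mult_strict_left_mono) auto
  then show "e / (2 * (1 + \<bar>c\<bar>)) * c < e"
    using pos_divide_less_eq[of "2 * (1 + \<bar>c\<bar>)" "e * c" e] by simp
qed

text \<open>The third derivative is encoded as the derivative of the matrix \<open>Lvv\<close> in
  the velocity, a bounded linear map from vectors to matrices.\<close>

locale smooth_lagrangian =
  fixes L Lt :: "real \<Rightarrow> real^'n \<Rightarrow> real^'n \<Rightarrow> real"
    and Lx Lv :: "real \<Rightarrow> real^'n \<Rightarrow> real^'n \<Rightarrow> real^'n"
    and Lxx Lxv Lvv :: "real \<Rightarrow> real^'n \<Rightarrow> real^'n \<Rightarrow> real^'n^'n"
    and Lvvv :: "real \<Rightarrow> real^'n \<Rightarrow> real^'n \<Rightarrow> (real^'n) \<Rightarrow>\<^sub>L (real^'n^'n)"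
    and a b :: real
  assumes L_deriv: "\<And>t x v. t \<in> {a<..<b} \<Longrightarrow>
          ((\<lambda>(t, x, v). L t x v) has_derivative
             (\<lambda>(dt, dx, dv). Lt t x v * dt + Lx t x v \<bullet> dx + Lv t x v \<bullet> dv)) (at (t, x, v))"
    and Lx_cont: "continuous_on ({a<..<b} \<times> UNIV \<times> UNIV) (\<lambda>(t, x, v). Lx t x v)"
    and Lxx_deriv: "\<And>t x v. t \<in> {a<..<b} \<Longrightarrow>
          ((\<lambda>y. Lx t y v) has_derivative (\<lambda>dx. Lxx t x v *v dx)) (at x)"
    and Lxv_deriv: "\<And>t x v. t \<in> {a<..<b} \<Longrightarrow>
          ((\<lambda>w. Lx t x w) has_derivative (\<lambda>dv. Lxv t x v *v dv)) (at v)"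
    and Lvv_deriv: "\<And>t x v. t \<in> {a<..<b} \<Longrightarrow>
          ((\<lambda>w. Lv t x w) has_derivative (\<lambda>dv. Lvv t x v *v dv)) (at v)"
    and Lvvv_deriv: "\<And>t x v. t \<in> {a<..<b} \<Longrightarrow>
          ((\<lambda>w. Lvv t x w) has_derivative blinfun_apply (Lvvv t x v)) (at v)"
    and Lxx_cont: "continuous_on ({a<..<b} \<times> UNIV \<times> UNIV) (\<lambda>(t, x, v). Lxx t x v)"
    and Lxv_cont: "continuous_on ({a<..<b} \<times> UNIV \<times> UNIV) (\<lambda>(t, x, v). Lxv t x v)"
    and Lvvv_cont: "continuous_on ({a<..<b} \<times> UNIV \<times> UNIV) (\<lambda>(t, x, v). Lvvv t x v)"
begin

lemma L_continuous_on: "continuous_on ({a<..<b} \<times> UNIV \<times> UNIV) (\<lambda>(t, x, v). L t x v)"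
proof (rule continuous_at_imp_continuous_on, rule ballI)
  fix p assume "p \<in> {a<..<b} \<times> (UNIV :: (real^'n) set) \<times> (UNIV :: (real^'n) set)"
  then show "isCont (\<lambda>(t, x, v). L t x v) p"
    by (cases p) (auto intro!: has_derivative_continuous L_deriv simp del: split_paired_All)
qed

section \<open>Derivatives along lines in position and velocity\<close>

lemma L_deriv_x:
  assumes "t \<in> {a<..<b}"
  shows "((\<lambda>s. L t (x + s *\<^sub>R h) v) has_real_derivative Lx t (x + s *\<^sub>R h) v \<bullet> h) (at s)"
proof -
  have "((\<lambda>s. (t, x + s *\<^sub>R h, v)) has_derivative (\<lambda>ds. (0, ds *\<^sub>R h, 0))) (at s)"
    by (auto intro!: derivative_eq_intros)
  from has_derivative_compose[OF this L_deriv[OF assms]] show ?thesis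
    by (simp add: has_field_derivative_def mult.commute[of "_ \<bullet> _"] mult_commute_abs)
qed

lemma L_deriv_v:
  assumes "t \<in> {a<..<b}"
  shows "((\<lambda>s. L t x (v + s *\<^sub>R h)) has_real_derivative Lv t x (v + s *\<^sub>R h) \<bullet> h) (at s)"
proof -
  have "((\<lambda>s. (t, x, v + s *\<^sub>R h)) has_derivative (\<lambda>ds. (0, 0, ds *\<^sub>R h))) (at s)"
    by (auto intro!: derivative_eq_intros)
  from has_derivative_compose[OF this L_deriv[OF assms]] show ?thesis
    by (simp add: has_field_derivative_def mult.commute[of "_ \<bullet> _"] mult_commute_abs)
qed

lemma Lx_deriv_x:
  assumes "t \<in> {a<..<b}"
  shows "((\<lambda>s. h \<bullet> Lx t (x + s *\<^sub>R h) v) has_real_derivative h \<bullet> (Lxx t (x + s *\<^sub>R h) v *v h)) (at s)"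
proof -
  have "((\<lambda>s. x + s *\<^sub>R h) has_derivative (\<lambda>ds. ds *\<^sub>R h)) (at s)"
    by (auto intro!: derivative_eq_intros)
  from has_derivative_inner_right[OF has_derivative_compose[OF this Lxx_deriv[OF assms]], of h]
  show ?thesis
    by (simp add: has_field_derivative_def mult_commute_abs matrix_vector_mult_scaleR)
qed

lemma Lx_deriv_v:
  assumes "t \<in> {a<..<b}"
  shows "((\<lambda>s. h \<bullet> Lx t x (v + s *\<^sub>R h)) has_real_derivative h \<bullet> (Lxv t x (v + s *\<^sub>R h) *v h)) (at s)"
proof -
  have "((\<lambda>s. v + s *\<^sub>R h) has_derivative (\<lambda>ds. ds *\<^sub>R h)) (at s)"
    by (auto intro!: derivative_eq_intros)
  from has_derivative_inner_right[OF has_derivative_compose[OF this Lxv_deriv[OF assms]], of h]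
  show ?thesis
    by (simp add: has_field_derivative_def mult_commute_abs matrix_vector_mult_scaleR)
qed

lemma Lv_deriv_v:
  assumes "t \<in> {a<..<b}"
  shows "((\<lambda>s. Lv t x (v + s *\<^sub>R h) \<bullet> h) has_real_derivative h \<bullet> (Lvv t x (v + s *\<^sub>R h) *v h)) (at s)"
proof -
  have "((\<lambda>s. v + s *\<^sub>R h) has_derivative (\<lambda>ds. ds *\<^sub>R h)) (at s)"
    by (auto intro!: derivative_eq_intros)
  from has_derivative_inner_right[OF has_derivative_compose[OF this Lvv_deriv[OF assms]], of h]
  show ?thesis
    by (simp add: has_field_derivative_def mult_commute_abs matrix_vector_mult_scaleR inner_commute)
qed

lemma Lvv_deriv_v:
  assumes "t \<in> {a<..<b}"
  shows "((\<lambda>s. h \<bullet> (Lvv t x (v + s *\<^sub>R h) *v h)) has_real_derivative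
            h \<bullet> (blinfun_apply (Lvvv t x (v + s *\<^sub>R h)) h *v h)) (at s)"
proof -
  have "((\<lambda>s. v + s *\<^sub>R h) has_derivative (\<lambda>ds. ds *\<^sub>R h)) (at s)"
    by (auto intro!: derivative_eq_intros)
  from bounded_linear.has_derivative[OF bounded_linear_quadratic_form
      has_derivative_compose[OF this Lvvv_deriv[OF assms]], of h]
  show ?thesis
    by (simp add: has_field_derivative_def mult_commute_abs blinfun.scaleR_right
        scaleR_matrix_vector_assoc[symmetric])
qed

lemma quadratic_forms_continuous_on:
  shows "continuous_on ({a<..<b} \<times> UNIV \<times> UNIV) (\<lambda>(t, x, v). \<eta> \<bullet> (Lxx t x v *v \<eta>))"
    and "continuous_on ({a<..<b} \<times> UNIV \<times> UNIV) (\<lambda>(t, x, v). \<eta> \<bullet> (Lxv t x v *v \<eta>))"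
    and "continuous_on ({a<..<b} \<times> UNIV \<times> UNIV) (\<lambda>(t, x, v). \<eta> \<bullet> (blinfun_apply (Lvvv t x v) \<eta> *v \<eta>))"
proof -
  have "continuous_on ({a<..<b} \<times> UNIV \<times> UNIV) (\<lambda>p. blinfun_apply ((\<lambda>(t, x, v). Lvvv t x v) p) \<eta>)"
    by (intro continuous_intros Lvvv_cont)
  note this[THEN bounded_linear.continuous_on[OF bounded_linear_quadratic_form[of \<eta>]]]
    Lxx_cont[THEN bounded_linear.continuous_on[OF bounded_linear_quadratic_form[of \<eta>]]]
    Lxv_cont[THEN bounded_linear.continuous_on[OF bounded_linear_quadratic_form[of \<eta>]]]
  then show "continuous_on ({a<..<b} \<times> UNIV \<times> UNIV) (\<lambda>(t, x, v). \<eta> \<bullet> (Lxx t x v *v \<eta>))"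
    "continuous_on ({a<..<b} \<times> UNIV \<times> UNIV) (\<lambda>(t, x, v). \<eta> \<bullet> (Lxv t x v *v \<eta>))"
    "continuous_on ({a<..<b} \<times> UNIV \<times> UNIV) (\<lambda>(t, x, v). \<eta> \<bullet> (blinfun_apply (Lvvv t x v) \<eta> *v \<eta>))"
    by (simp_all add: case_prod_unfold)
qed

section \<open>Expansions of the Lagrangian near a point\<close>

text \<open>Serves the steep side of the tent, where the velocity is shifted by the whole of
  \<open>\<eta>\<close>. The derivative in \<open>k\<close> of the expression inside the absolute
  value compares two values of \<open>Lx\<close> with their limits at \<open>\<theta>\<close>, so it
  is small near the base point.\<close>

lemma shift_x_estimate:
  assumes "\<theta> \<in> {a<..<b}" "\<omega> > 0"
  obtains d where "d > 0" "\<And>t x v k. \<bar>t - \<theta>\<bar> < d \<Longrightarrow> dist x x0 < d \<Longrightarrow> dist v v0 < d \<Longrightarrow> \<bar>k\<bar> < d \<Longrightarrow>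
      \<bar>L t (x + k *\<^sub>R \<eta>) (v + \<eta>) - L t x (v + \<eta>) - k * (Lx t x v \<bullet> \<eta>)
        - k * (\<eta> \<bullet> (Lx \<theta> x0 (v0 + \<eta>) - Lx \<theta> x0 v0))\<bar> \<le> \<omega> * \<bar>k\<bar>"
proof -
  \<comment> \<open>Each of the two gradients deviates by less than \<open>e\<close>, and both are
    paired with \<open>\<eta>\<close>; this is the factor 2.\<close>
  obtain e where e: "e > 0" "e * (2 * norm \<eta>) < \<omega>" using obtain_small_multiple[OF assms(2)] by blast
  obtain d1 where d1: "d1 > 0" "\<And>t x v. \<bar>t - \<theta>\<bar> < d1 \<Longrightarrow> dist x x0 < d1 \<Longrightarrow> dist v (v0 + \<eta>) < d1 \<Longrightarrow>
      t \<in> {a<..<b} \<and> dist (Lx t x v) (Lx \<theta> x0 (v0 + \<eta>)) < e"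
    using continuous_on_near[OF Lx_cont assms(1) e(1)] by blast
  obtain d2 where d2: "d2 > 0" "\<And>t x v. \<bar>t - \<theta>\<bar> < d2 \<Longrightarrow> dist x x0 < d2 \<Longrightarrow> dist v v0 < d2 \<Longrightarrow>
      t \<in> {a<..<b} \<and> dist (Lx t x v) (Lx \<theta> x0 v0) < e"
    using continuous_on_near[OF Lx_cont assms(1) e(1)] by blast
  \<comment> \<open>Half of the radius \<open>d1\<close> is spent on the distance of
    \<open>x\<close> from \<open>x0\<close>, the other half on the shift along
    \<open>\<eta>\<close>.\<close>
  obtain d3 where d3: "d3 > 0" "d3 * norm \<eta> < d1 / 2" using obtain_small_multiple[of "d1 / 2"] d1(1) by auto
  define d where "d = min (min (d1 / 2) d2) d3"
  have d: "d > 0" "d \<le> d1 / 2" "d \<le> d2" "d \<le> d3" using d1 d2 d3 by (auto simp: d_def)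
  show ?thesis
  proof (rule that[OF d(1)])
    fix t x v k assume *: "\<bar>t - \<theta>\<bar> < d" "dist x x0 < d" "dist v v0 < d" "\<bar>k\<bar> < d"
    let ?Q = "\<eta> \<bullet> (Lx \<theta> x0 (v0 + \<eta>) - Lx \<theta> x0 v0)"
    let ?f = "\<lambda>s. L t (x + s *\<^sub>R \<eta>) (v + \<eta>) - s * (Lx t x v \<bullet> \<eta>) - s * ?Q"
    let ?f' = "\<lambda>s. Lx t (x + s *\<^sub>R \<eta>) (v + \<eta>) \<bullet> \<eta> - Lx t x v \<bullet> \<eta> - ?Q"
    have t: "t \<in> {a<..<b}" using d2(2)[of t x v] * d by auto
    have "\<bar>?f k - ?f 0\<bar> \<le> \<omega> * \<bar>k\<bar>"
    proof (rule real_lipschitz_bound)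
      fix s assume s: "\<bar>s\<bar> \<le> \<bar>k\<bar>"
      show "(?f has_real_derivative ?f' s) (at s)"
        using t by (auto intro!: derivative_eq_intros L_deriv_x)
      have "\<bar>s\<bar> * norm \<eta> \<le> d3 * norm \<eta>" using s * d by (intro mult_right_mono) auto
      then have "dist (x + s *\<^sub>R \<eta>) x0 < d1"
        using norm_triangle_ineq[of "x - x0" "s *\<^sub>R \<eta>"] * d d3
        by (simp add: dist_norm algebra_simps)
      then have 1: "dist (Lx t (x + s *\<^sub>R \<eta>) (v + \<eta>)) (Lx \<theta> x0 (v0 + \<eta>)) < e"
        using d1(2)[of t "x + s *\<^sub>R \<eta>" "v + \<eta>"] * d d1(1) by (simp add: dist_norm)
      have 2: "dist (Lx t x v) (Lx \<theta> x0 v0) < e" using d2(2)[of t x v] * d by auto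
      have "?f' s = (Lx t (x + s *\<^sub>R \<eta>) (v + \<eta>) - Lx \<theta> x0 (v0 + \<eta>)) \<bullet> \<eta> - (Lx t x v - Lx \<theta> x0 v0) \<bullet> \<eta>"
        by (simp add: inner_diff_left inner_diff_right inner_commute)
      also have "\<bar>\<dots>\<bar> \<le> e * norm \<eta> + e * norm \<eta>"
        by (intro order_trans[OF abs_triangle_ineq4] add_mono order_trans[OF Cauchy_Schwarz_ineq2]
            mult_right_mono) (use 1 2 in \<open>auto simp: dist_norm\<close>)
      finally show "\<bar>?f' s\<bar> \<le> \<omega>" using e(2) by simp
    qed
    moreover have "L t (x + k *\<^sub>R \<eta>) (v + \<eta>) - L t x (v + \<eta>) - k * (Lx t x v \<bullet> \<eta>) - k * ?Q = ?f k - ?f 0"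
      by simp
    ultimately show "\<bar>L t (x + k *\<^sub>R \<eta>) (v + \<eta>) - L t x (v + \<eta>) - k * (Lx t x v \<bullet> \<eta>) - k * ?Q\<bar> \<le> \<omega> * \<bar>k\<bar>"
      by (simp only:)
  qed
qed

text \<open>Serves the flat side of the tent, with velocity shift \<open>c *\<^sub>R \<eta>\<close>
  for small \<open>c\<close>. One factor \<open>c\<close> comes from the direction of the position
  shift, the other from the change of \<open>Lx\<close>: its velocity part is \<open>c\<close> times
  the \<open>Lxv\<close> form to leading order, and its position part is of order
  \<open>k * c\<close>, absorbed by taking \<open>k\<close> small.\<close>

lemma small_shift_x_estimate:
  assumes "\<theta> \<in> {a<..<b}" "\<omega> > 0"
  obtains d where "d > 0" "\<And>t x v k c. \<bar>t - \<theta>\<bar> < d \<Longrightarrow> dist x x0 < d \<Longrightarrow> dist v v0 < d \<Longrightarrow>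
      \<bar>k\<bar> < d \<Longrightarrow> \<bar>c\<bar> < d \<Longrightarrow>
      \<bar>L t (x + k *\<^sub>R (c *\<^sub>R \<eta>)) (v + c *\<^sub>R \<eta>) - L t x (v + c *\<^sub>R \<eta>) - k * (Lx t x v \<bullet> (c *\<^sub>R \<eta>))
        - k * (c\<^sup>2 * (\<eta> \<bullet> (Lxv \<theta> x0 v0 *v \<eta>)))\<bar> \<le> \<omega> * c\<^sup>2 * \<bar>k\<bar>"
proof -
  let ?Q = "\<eta> \<bullet> (Lxv \<theta> x0 v0 *v \<eta>)" and ?P = "\<bar>\<eta> \<bullet> (Lxx \<theta> x0 v0 *v \<eta>)\<bar> + 1"
  obtain d1 where d1: "d1 > 0" "\<And>t x v. \<bar>t - \<theta>\<bar> < d1 \<Longrightarrow> dist x x0 < d1 \<Longrightarrow> dist v v0 < d1 \<Longrightarrow>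
      t \<in> {a<..<b} \<and> dist (\<eta> \<bullet> (Lxx t x v *v \<eta>)) (\<eta> \<bullet> (Lxx \<theta> x0 v0 *v \<eta>)) < 1"
    using continuous_on_near[OF quadratic_forms_continuous_on(1) assms(1) zero_less_one] by blast
  have "\<omega> / 2 > 0" using assms(2) by simp
  then obtain d2 where d2: "d2 > 0" "\<And>t x v. \<bar>t - \<theta>\<bar> < d2 \<Longrightarrow> dist x x0 < d2 \<Longrightarrow> dist v v0 < d2 \<Longrightarrow>
      t \<in> {a<..<b} \<and> dist (\<eta> \<bullet> (Lxv t x v *v \<eta>)) ?Q < \<omega> / 2"
    using continuous_on_near[OF quadratic_forms_continuous_on(2) assms(1)] by blast
  \<comment> \<open>Base points stay within \<open>m\<close> and shifts within \<open>m\<close>, so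
    shifted points stay within the radius \<open>2 * m\<close> of both continuity
    statements.\<close>
  define m where "m = min d1 d2 / 2"
  have m: "m > 0" "2 * m \<le> d1" "2 * m \<le> d2" using d1(1) d2(1) by (auto simp: m_def)
  obtain d3 where d3: "d3 > 0" "d3 * norm \<eta> < m" using obtain_small_multiple[OF m(1)] by blast
  obtain d4 where d4: "d4 > 0" "d4 * ?P < \<omega> / 2" using obtain_small_multiple[OF \<open>\<omega> / 2 > 0\<close>] by blast
  define d where "d = min (min m 1) (min d3 d4)"
  have d: "d > 0" "d \<le> m" "d \<le> 1" "d \<le> d3" "d \<le> d4" using m d3 d4 by (auto simp: d_def)
  show ?thesis
  proof (rule that[OF d(1)])
    fix t x v k c assume *: "\<bar>t - \<theta>\<bar> < d" "dist x x0 < d" "dist v v0 < d" "\<bar>k\<bar> < d" "\<bar>c\<bar> < d"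
    have t: "t \<in> {a<..<b}" using d2(2)[of t x v] * d m by auto
    have shift: "dist (y + s *\<^sub>R \<eta>) y0 < 2 * m" if "\<bar>s\<bar> \<le> d" "dist y y0 < d" for s and y y0 :: "real^'n"
    proof -
      have "\<bar>s\<bar> * norm \<eta> \<le> d3 * norm \<eta>" using that d by (intro mult_right_mono) auto
      then show ?thesis
        using norm_triangle_ineq[of "y - y0" "s *\<^sub>R \<eta>"] that d d3
        by (simp add: dist_norm algebra_simps)
    qed
    let ?f = "\<lambda>s. L t (x + s *\<^sub>R (c *\<^sub>R \<eta>)) (v + c *\<^sub>R \<eta>) - s * (Lx t x v \<bullet> (c *\<^sub>R \<eta>)) - s * (c\<^sup>2 * ?Q)"
    let ?f' = "\<lambda>s. Lx t (x + s *\<^sub>R (c *\<^sub>R \<eta>)) (v + c *\<^sub>R \<eta>) \<bullet> (c *\<^sub>R \<eta>) - Lx t x v \<bullet> (c *\<^sub>R \<eta>) - c\<^sup>2 * ?Q"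
    have "\<bar>?f k - ?f 0\<bar> \<le> (\<omega> * c\<^sup>2) * \<bar>k\<bar>"
    proof (rule real_lipschitz_bound)
      fix s assume s: "\<bar>s\<bar> \<le> \<bar>k\<bar>"
      show "(?f has_real_derivative ?f' s) (at s)"
        using L_deriv_x[OF t, of x "c *\<^sub>R \<eta>" "v + c *\<^sub>R \<eta>" s]
        by (rule DERIV_diff[OF DERIV_diff]) (auto intro!: derivative_eq_intros)
      \<comment> \<open>The change of \<open>Lx\<close> is split in two: \<open>?g\<close> moves the
        position with the velocity already shifted, and \<open>?h\<close> below moves the velocity
        at the original position with the main term removed.\<close>
      let ?g = "\<lambda>r. \<eta> \<bullet> Lx t (x + r *\<^sub>R \<eta>) (v + c *\<^sub>R \<eta>)"
      \<comment> \<open>The first bound retains the factor \<open>\<bar>c\<bar>\<close> needed for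
        the final order; the second keeps the moved position in the controlled
        neighbourhood.\<close>
      have sc: "\<bar>s * c\<bar> \<le> d4 * \<bar>c\<bar>" "\<bar>s * c\<bar> \<le> d"
      proof -
        show "\<bar>s * c\<bar> \<le> d4 * \<bar>c\<bar>" using s * d by (simp add: abs_mult mult_right_mono)
        have "\<bar>s * c\<bar> \<le> d * 1" using s * d unfolding abs_mult by (intro mult_mono) auto
        then show "\<bar>s * c\<bar> \<le> d" by simp
      qed
      have "\<bar>?g (s * c) - ?g 0\<bar> \<le> ?P * \<bar>s * c\<bar>"
      proof (rule real_lipschitz_bound)
        fix r assume r: "\<bar>r\<bar> \<le> \<bar>s * c\<bar>"
        show "(?g has_real_derivative \<eta> \<bullet> (Lxx t (x + r *\<^sub>R \<eta>) (v + c *\<^sub>R \<eta>) *v \<eta>)) (at r)"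
          by (rule Lx_deriv_x[OF t])
        have "\<bar>t - \<theta>\<bar> < d1" "dist (x + r *\<^sub>R \<eta>) x0 < d1" "dist (v + c *\<^sub>R \<eta>) v0 < d1"
          using shift[of r x x0] shift[of c v v0] r sc * d m by linarith+
        from d1(2)[OF this] show "\<bar>\<eta> \<bullet> (Lxx t (x + r *\<^sub>R \<eta>) (v + c *\<^sub>R \<eta>) *v \<eta>)\<bar> \<le> ?P"
          unfolding dist_real_def by linarith
      qed
      also have "\<dots> \<le> ?P * (d4 * \<bar>c\<bar>)" using sc by (intro mult_left_mono) auto
      also have "\<dots> = (d4 * ?P) * \<bar>c\<bar>" by simp
      also have "\<dots> \<le> \<omega> / 2 * \<bar>c\<bar>" using d4 by (intro mult_right_mono) auto
      finally have 1: "\<bar>?g (s * c) - ?g 0\<bar> \<le> \<omega> / 2 * \<bar>c\<bar>" .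
      let ?h = "\<lambda>r. \<eta> \<bullet> Lx t x (v + r *\<^sub>R \<eta>) - r * ?Q"
      have "\<bar>?h c - ?h 0\<bar> \<le> \<omega> / 2 * \<bar>c\<bar>"
      proof (rule real_lipschitz_bound)
        fix r assume r: "\<bar>r\<bar> \<le> \<bar>c\<bar>"
        show "(?h has_real_derivative \<eta> \<bullet> (Lxv t x (v + r *\<^sub>R \<eta>) *v \<eta>) - ?Q) (at r)"
          using t by (auto intro!: derivative_eq_intros Lx_deriv_v)
        have "\<bar>t - \<theta>\<bar> < d2" "dist x x0 < d2" "dist (v + r *\<^sub>R \<eta>) v0 < d2"
          using shift[of r v v0] r * d m by linarith+
        from d2(2)[OF this] show "\<bar>\<eta> \<bullet> (Lxv t x (v + r *\<^sub>R \<eta>) *v \<eta>) - ?Q\<bar> \<le> \<omega> / 2"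
          unfolding dist_real_def by linarith
      qed
      with 1 have "\<bar>(?g (s * c) - ?g 0) + (?h c - ?h 0)\<bar> \<le> \<omega> * \<bar>c\<bar>" by linarith
      \<comment> \<open>The two changes add up to the derivative \<open>?f' s\<close> with one
        factor \<open>c\<close> taken out; that factor is restored here.\<close>
      then have "\<bar>c\<bar> * \<bar>(?g (s * c) - ?g 0) + (?h c - ?h 0)\<bar> \<le> \<bar>c\<bar> * (\<omega> * \<bar>c\<bar>)"
        by (rule mult_left_mono) simp
      also have "\<bar>c\<bar> * \<bar>(?g (s * c) - ?g 0) + (?h c - ?h 0)\<bar> = \<bar>?f' s\<bar>"
        unfolding abs_mult[symmetric]
        by (simp add: algebra_simps power2_eq_square inner_commute)
      also have "\<bar>c\<bar> * (\<omega> * \<bar>c\<bar>) = \<omega> * c\<^sup>2" by (simp add: power2_eq_square)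
      finally show "\<bar>?f' s\<bar> \<le> \<omega> * c\<^sup>2" .
    qed
    moreover have "L t (x + k *\<^sub>R (c *\<^sub>R \<eta>)) (v + c *\<^sub>R \<eta>) - L t x (v + c *\<^sub>R \<eta>) - k * (Lx t x v \<bullet> (c *\<^sub>R \<eta>))
        - k * (c\<^sup>2 * ?Q) = ?f k - ?f 0"
      by simp
    ultimately show "\<bar>L t (x + k *\<^sub>R (c *\<^sub>R \<eta>)) (v + c *\<^sub>R \<eta>) - L t x (v + c *\<^sub>R \<eta>) - k * (Lx t x v \<bullet> (c *\<^sub>R \<eta>))
        - k * (c\<^sup>2 * ?Q)\<bar> \<le> \<omega> * c\<^sup>2 * \<bar>k\<bar>"
      by (simp only:)
  qed
qed

text \<open>Taylor expansion in the velocity along \<open>\<eta>\<close>: the quadratic term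
  vanishes by degeneracy, and continuity of \<open>Lvvv\<close> bounds the cubic remainder. The
  constants \<open>C\<close> and \<open>d\<close> are uniform over nearby base points, with
  degeneracy demanded only at the base point in question.\<close>

lemma degenerate_excess_estimate:
  assumes "\<theta> \<in> {a<..<b}"
  obtains C d where "d > 0" "C \<ge> 0" "\<And>t x v c. \<bar>t - \<theta>\<bar> < d \<Longrightarrow> dist x x0 < d \<Longrightarrow> dist v v0 < d \<Longrightarrow>
      \<bar>c\<bar> < d \<Longrightarrow> \<eta> \<bullet> (Lvv t x v *v \<eta>) = 0 \<Longrightarrow>
      \<bar>L t x (v + c *\<^sub>R \<eta>) - L t x v - c * (Lv t x v \<bullet> \<eta>)\<bar> \<le> C * \<bar>c\<bar> ^ 3"
proof -
  let ?q = "\<lambda>t x v. \<eta> \<bullet> (blinfun_apply (Lvvv t x v) \<eta> *v \<eta>)"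
  let ?P = "\<bar>?q \<theta> x0 v0\<bar> + 1"
  obtain d1 where d1: "d1 > 0" "\<And>t x v. \<bar>t - \<theta>\<bar> < d1 \<Longrightarrow> dist x x0 < d1 \<Longrightarrow> dist v v0 < d1 \<Longrightarrow>
      t \<in> {a<..<b} \<and> dist (?q t x v) (?q \<theta> x0 v0) < 1"
    using continuous_on_near[OF quadratic_forms_continuous_on(3) assms(1) zero_less_one] by blast
  obtain d3 where d3: "d3 > 0" "d3 * norm \<eta> < d1 / 2" using obtain_small_multiple[of "d1 / 2"] d1(1) by auto
  define d where "d = min (d1 / 2) d3"
  have d: "d > 0" "d \<le> d1 / 2" "d \<le> d3" using d1 d3 by (auto simp: d_def)
  show ?thesis
  proof (rule that[OF d(1)])
    show "0 \<le> ?P" by simp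
    fix t x v c assume *: "\<bar>t - \<theta>\<bar> < d" "dist x x0 < d" "dist v v0 < d" "\<bar>c\<bar> < d"
      and D: "\<eta> \<bullet> (Lvv t x v *v \<eta>) = 0"
    have t: "t \<in> {a<..<b}" using d1 d1(2)[of t x v] * d by auto
    \<comment> \<open>The successive derivatives along the line, arranged as the sequence that
      Maclaurin's theorem takes; orders 0 to 3 occur.\<close>
    define diff where "diff m s = (if m = 0 then L t x (v + s *\<^sub>R \<eta>)
       else if m = 1 then Lv t x (v + s *\<^sub>R \<eta>) \<bullet> \<eta>
       else if m = 2 then \<eta> \<bullet> (Lvv t x (v + s *\<^sub>R \<eta>) *v \<eta>)
       else ?q t x (v + s *\<^sub>R \<eta>))" for m :: nat and s
    have diff: "diff 0 = (\<lambda>s. L t x (v + s *\<^sub>R \<eta>))" "diff (Suc 0) = (\<lambda>s. Lv t x (v + s *\<^sub>R \<eta>) \<bullet> \<eta>)"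
      "diff 2 = (\<lambda>s. \<eta> \<bullet> (Lvv t x (v + s *\<^sub>R \<eta>) *v \<eta>))" "diff 3 = (\<lambda>s. ?q t x (v + s *\<^sub>R \<eta>))"
      by (auto simp: diff_def)
    have "DERIV (diff m) s :> diff (Suc m) s" if "m < 3" for m s
    proof -
      from that consider "m = 0" | "m = 1" | "m = 2" by linarith
      then show ?thesis
        using L_deriv_v[OF t] Lv_deriv_v[OF t] Lvv_deriv_v[OF t]
        by cases (simp_all add: diff flip: numeral_2_eq_2 numeral_3_eq_3)
    qed
    then have "\<forall>m s. m < 3 \<and> \<bar>s\<bar> \<le> \<bar>c\<bar> \<longrightarrow> DERIV (diff m) s :> diff (Suc m) s" by blast
    from Maclaurin_bi_le[OF diff(1) this] obtain s where s: "\<bar>s\<bar> \<le> \<bar>c\<bar>"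
      "L t x (v + c *\<^sub>R \<eta>) = (\<Sum>m<3. diff m 0 / fact m * c ^ m) + diff 3 s / fact 3 * c ^ 3"
      by (elim exE conjE) (rule that)
    have "(\<Sum>m<3. diff m 0 / fact m * c ^ m) = L t x v + c * (Lv t x v \<bullet> \<eta>)"
    proof -
      have "{..<3::nat} = {0, 1, 2}" by auto
      then show ?thesis using D by (simp add: diff_def)
    qed
    with s have "L t x (v + c *\<^sub>R \<eta>) - L t x v - c * (Lv t x v \<bullet> \<eta>) = ?q t x (v + s *\<^sub>R \<eta>) / 6 * c ^ 3"
      by (simp add: diff fact_numeral)
    also have "\<bar>\<dots>\<bar> \<le> ?P * \<bar>c\<bar> ^ 3"
    proof -
      have "\<bar>s\<bar> * norm \<eta> \<le> d3 * norm \<eta>" using s * d by (intro mult_right_mono) auto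
      then have "dist (v + s *\<^sub>R \<eta>) v0 < d1"
        using norm_triangle_ineq[of "v - v0" "s *\<^sub>R \<eta>"] * d d3 by (simp add: dist_norm algebra_simps)
      moreover have "\<bar>t - \<theta>\<bar> < d1" "dist x x0 < d1" using * d d1(1) by linarith+
      ultimately have "dist (?q t x (v + s *\<^sub>R \<eta>)) (?q \<theta> x0 v0) < 1" using d1(2) by blast
      then have "\<bar>?q t x (v + s *\<^sub>R \<eta>)\<bar> \<le> ?P" unfolding dist_real_def by linarith
      \<comment> \<open>The factorial 6 is simply discarded; only the cubic order matters.\<close>
      then have "\<bar>?q t x (v + s *\<^sub>R \<eta>) / 6\<bar> \<le> ?P" by simp
      then show ?thesis unfolding abs_mult power_abs by (intro mult_right_mono) auto
    qed
    finally show "\<bar>L t x (v + c *\<^sub>R \<eta>) - L t x v - c * (Lv t x v \<bullet> \<eta>)\<bar> \<le> ?P * \<bar>c\<bar> ^ 3" .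
  qed
qed

end

subsection \<open>Tent variations\<close>

text \<open>The integrand lies between two affine functions with explicit integrals. The error
  \<open>e\<close> is proportional to the ramp, as for a position shift; \<open>e'\<close> is
  uniform, as for the excess.\<close>

lemma integral_near_ramp_left:
  fixes f :: "real \<Rightarrow> real"
  assumes "(f has_integral I) {u..w}" "u \<le> w"
    and bound: "\<And>t. t \<in> {u..w} \<Longrightarrow> \<bar>f t - k * (t - u)\<bar> \<le> e * (t - u) + e'"
  shows "\<bar>I - k * ((w - u)\<^sup>2 / 2)\<bar> \<le> e * ((w - u)\<^sup>2 / 2) + e' * (w - u)"
proof -
  have ramp: "((\<lambda>t. c * (t - u) + c') has_integral c * ((w - u)\<^sup>2 / 2) + c' * (w - u)) {u..w}" for c c' :: real
  proof -
    have "((\<lambda>t. c * ((t - u)\<^sup>2 / 2) + c' * (t - u)) has_vector_derivative c * (t - u) + c') (at t within {u..w})" for t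
      unfolding has_real_derivative_iff_has_vector_derivative[symmetric]
      by (auto intro!: derivative_eq_intros)
    from fundamental_theorem_of_calculus[OF assms(2) this] show ?thesis by simp
  qed
  have "I \<le> (k + e) * ((w - u)\<^sup>2 / 2) + e' * (w - u)"
    by (rule has_integral_le[OF assms(1) ramp]) (use bound in \<open>force simp: abs_le_iff algebra_simps\<close>)
  moreover have "(k - e) * ((w - u)\<^sup>2 / 2) + (- e') * (w - u) \<le> I"
    by (rule has_integral_le[OF ramp assms(1)]) (use bound in \<open>force simp: abs_le_iff algebra_simps\<close>)
  ultimately show ?thesis by (simp only: abs_le_iff distrib_right left_diff_distrib) linarith
qed

text \<open>Reflection in time reduces this to the previous case. The ramp now vanishes at the right
  end and has the opposite sign, hence the plus in front of \<open>k\<close>.\<close>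

lemma integral_near_ramp_right:
  fixes f :: "real \<Rightarrow> real"
  assumes "(f has_integral I) {u..w}" "u \<le> w"
    and bound: "\<And>t. t \<in> {u..w} \<Longrightarrow> \<bar>f t - k * (t - w)\<bar> \<le> e * (w - t) + e'"
  shows "\<bar>I + k * ((w - u)\<^sup>2 / 2)\<bar> \<le> e * ((w - u)\<^sup>2 / 2) + e' * (w - u)"
proof -
  have "((\<lambda>t. f (- t)) has_integral I) {- w..- u}"
    using assms(1) by (simp add: has_integral_reflect_real)
  moreover have "\<bar>f (- t) - (- k) * (t - - w)\<bar> \<le> e * (t - - w) + e'" if "t \<in> {- w..- u}" for t
    using bound[of "- t"] that by (simp add: algebra_simps)
  ultimately have "\<bar>I - (- k) * ((- u - - w)\<^sup>2 / 2)\<bar> \<le> e * ((- u - - w)\<^sup>2 / 2) + e' * (- u - - w)"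
    using assms(2) by (intro integral_near_ramp_left) auto
  then show ?thesis by simp
qed

text \<open>The ramp coefficients are the slope jumps at \<open>p\<close>, \<open>m\<close> and
  \<open>r\<close>. The function returns to zero after \<open>r\<close> only under the balance
  \<open>c * (m - p) + c' * (r - m) = 0\<close>, which is imposed separately.\<close>

definition tent :: "real \<Rightarrow> real \<Rightarrow> real \<Rightarrow> real \<Rightarrow> real \<Rightarrow> 'a::real_normed_vector \<Rightarrow> real \<Rightarrow> 'a" where
  "tent p m r c c' \<eta> t = max 0 (t - p) *\<^sub>R (c *\<^sub>R \<eta>)
     + (max 0 (t - m) *\<^sub>R ((c' - c) *\<^sub>R \<eta>) + max 0 (t - r) *\<^sub>R ((- c') *\<^sub>R \<eta>))"

text \<open>The value 0 at the three kinks is a convention; agreement with the derivative is claimed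
  only away from them.\<close>

definition tent_slope :: "real \<Rightarrow> real \<Rightarrow> real \<Rightarrow> real \<Rightarrow> real \<Rightarrow> real \<Rightarrow> real" where
  "tent_slope p m r c c' t = (if p < t \<and> t < m then c else if m < t \<and> t < r then c' else 0)"

lemma tent_KC1:
  assumes "t0 < p" "p < m" "m < r" "r < t1"
  shows "tent p m r c c' \<eta> \<in> KC1 t0 t1"
proof -
  have "t0 < t1" using assms by simp
  then show ?thesis unfolding tent_def[abs_def] using assms
    by (intro KC1_add KC1_ramp) simp_all
qed

lemma tent_has_vector_derivative:
  assumes "p < m" "m < r" "t \<notin> {p, m, r}"
  shows "(tent p m r c c' \<eta> has_vector_derivative tent_slope p m r c c' t *\<^sub>R \<eta>) (at t within A)"
proof -
  have "(tent p m r c c' \<eta> has_vector_derivative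
     (if t < p then 0 else c *\<^sub>R \<eta>) + ((if t < m then 0 else (c' - c) *\<^sub>R \<eta>) + (if t < r then 0 else (- c') *\<^sub>R \<eta>)))
     (at t within A)"
    unfolding tent_def[abs_def] using assms(3)
    by (intro has_vector_derivative_add ramp_has_vector_derivative) auto
  also have "(if t < p then 0 else c *\<^sub>R \<eta>) + ((if t < m then 0 else (c' - c) *\<^sub>R \<eta>) + (if t < r then 0 else (- c') *\<^sub>R \<eta>))
     = tent_slope p m r c c' t *\<^sub>R \<eta>"
    using assms by (auto simp: tent_slope_def scaleR_left_diff_distrib)
  finally show ?thesis .
qed

text \<open>By the balance the ramps cancel beyond \<open>r\<close>, and the second side can be
  measured from its zero \<open>r\<close>. Both sides thus have the form slope times distance from a
  zero, and one \<open>increment\<close> function covers them.\<close>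

lemma tent_values:
  assumes "p < m" "m < r" and bal: "c * (m - p) + c' * (r - m) = 0"
  shows "t \<notin> {p..r} \<Longrightarrow> tent p m r c c' \<eta> t = 0"
    and "t \<in> {p..m} \<Longrightarrow> tent p m r c c' \<eta> t = (c * (t - p)) *\<^sub>R \<eta>"
    and "t \<in> {m..r} \<Longrightarrow> tent p m r c c' \<eta> t = (c' * (t - r)) *\<^sub>R \<eta>"
proof -
  have eq: "tent p m r c c' \<eta> t = (c * max 0 (t - p) + (c' - c) * max 0 (t - m) - c' * max 0 (t - r)) *\<^sub>R \<eta>"
    by (simp add: tent_def algebra_simps)
  show "t \<notin> {p..r} \<Longrightarrow> tent p m r c c' \<eta> t = 0"
  proof -
    assume t: "t \<notin> {p..r}"
    have "c * (t - p) + (c' - c) * (t - m) - c' * (t - r) = 0" using bal by (simp add: algebra_simps)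
    then have "c * max 0 (t - p) + (c' - c) * max 0 (t - m) - c' * max 0 (t - r) = 0"
      using t assms(1,2) by (cases "t < p") (auto simp: max_def)
    then show ?thesis unfolding eq by simp
  qed
  show "t \<in> {p..m} \<Longrightarrow> tent p m r c c' \<eta> t = (c * (t - p)) *\<^sub>R \<eta>"
    unfolding eq using assms by (auto simp: max_def)
  have "c * (t - p) + (c' - c) * (t - m) = c' * (t - r)" using bal by (simp add: algebra_simps)
  then show "t \<in> {m..r} \<Longrightarrow> tent p m r c c' \<eta> t = (c' * (t - r)) *\<^sub>R \<eta>"
    unfolding eq using assms(1,2) by (auto simp: max_def)
qed

text \<open>The extreme value is attained at \<open>m\<close>; on the second side the balance trades
  \<open>\<bar>c'\<bar> * (r - m)\<close> for \<open>\<bar>c\<bar> * (m - p)\<close>.\<close>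

lemma norm_tent_le:
  assumes "p < m" "m < r" and bal: "c * (m - p) + c' * (r - m) = 0"
  shows "norm (tent p m r c c' \<eta> t) \<le> \<bar>c\<bar> * (m - p) * norm \<eta>"
proof -
  consider "t \<notin> {p..r}" | "t \<in> {p..m}" | "t \<in> {m..r}" by force
  then show ?thesis
  proof cases
    case 1
    then show ?thesis using assms(1) by (simp add: tent_values(1)[OF assms])
  next
    case 2
    then have "\<bar>c * (t - p)\<bar> \<le> \<bar>c\<bar> * (m - p)" unfolding abs_mult by (intro mult_left_mono) auto
    then show ?thesis by (simp add: tent_values(2)[OF assms 2] mult_right_mono)
  next
    case 3
    then have "\<bar>c' * (t - r)\<bar> \<le> \<bar>c'\<bar> * (r - m)" unfolding abs_mult by (intro mult_left_mono) auto
    also have "\<dots> = \<bar>c' * (r - m)\<bar>" using assms(2) by (simp add: abs_mult)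
    also have "c' * (r - m) = - (c * (m - p))" using bal by simp
    also have "\<bar>- (c * (m - p))\<bar> = \<bar>c\<bar> * (m - p)" using assms(1) by (simp add: abs_mult)
    finally show ?thesis by (simp add: tent_values(3)[OF assms 3] mult_right_mono)
  qed
qed

lemma velocity_add_tent:
  assumes "x \<in> KC1 t0 t1" "t0 < t1" "p < m" "m < r" "t \<in> {t0..t1} - (angular_points t0 t1 x \<union> {p, m, r})"
  shows "velocity t0 t1 (\<lambda>s. x s + tent p m r c c' \<eta> s) t = velocity t0 t1 x t + tent_slope p m r c c' t *\<^sub>R \<eta>"
  using assms KC1_C1_point[OF assms(1)]
  by (intro velocity_eqI has_vector_derivative_add C1_point_has_velocity tent_has_vector_derivative) auto

lemma C_norm_tent_le:
  assumes "t0 < t1" "p < m" "m < r" "c * (m - p) + c' * (r - m) = 0"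
  shows "C_norm t0 t1 (\<lambda>t. (x t + tent p m r c c' \<eta> t) - x t) \<le> \<bar>c\<bar> * (m - p) * norm \<eta>"
  unfolding C_norm_def using assms(1) norm_tent_le[OF assms(2-4)] by (intro cSUP_least) auto

text \<open>Off a finite set the velocity difference is the tent slope times \<open>\<eta>\<close>.
  This yields both the measurability and the almost everywhere bound.\<close>

lemma Linf_norm_velocity_tent_le:
  fixes \<eta> :: "'a::real_normed_vector"
  assumes "x \<in> KC1 t0 t1" "t0 < t1" "p < m" "m < r" "\<bar>c\<bar> \<le> 1" "\<bar>c'\<bar> \<le> 1"
  shows "Linf_norm t0 t1 (\<lambda>t. velocity t0 t1 (\<lambda>s. x s + tent p m r c c' \<eta> s) t - velocity t0 t1 x t)
           \<le> ereal (norm \<eta>)"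
  unfolding Linf_norm_def
proof (rule esssup_I)
  let ?f = "\<lambda>t. ereal (norm (velocity t0 t1 (\<lambda>s. x s + tent p m r c c' \<eta> s) t - velocity t0 t1 x t))"
  let ?g = "\<lambda>t. ereal (\<bar>tent_slope p m r c c' t\<bar> * norm \<eta>)"
  \<comment> \<open>Intersecting with the interval makes the singletons of the exceptional set
    measurable in the restricted space.\<close>
  let ?X = "{t0..t1} \<inter> (angular_points t0 t1 x \<union> {p, m, r})"
  have fin: "finite ?X" using assms(1) by (auto simp: KC1_def)
  have eq: "?g t = ?f t" if "t \<in> {t0..t1}" "t \<notin> ?X" for t
    using velocity_add_tent[OF assms(1-4), of t c c' \<eta>] that by simp
  have "?g \<in> borel_measurable lborel" unfolding tent_slope_def by measurable
  then have g: "?g \<in> borel_measurable (lebesgue_on {t0..t1})"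
    by (intro measurable_restrict_space1 measurable_completion)
  show "?f \<in> borel_measurable (lebesgue_on {t0..t1})"
    by (rule measurable_discrete_difference[OF g countable_finite[OF fin]])
      (use eq in \<open>auto simp: sets_restrict_space\<close>)
  have "AE t in lebesgue. t \<notin> ?X"
    using fin by (intro AE_not_in negligible_iff_null_sets[THEN iffD1] negligible_finite)
  moreover have "?f t \<le> ereal (norm \<eta>)" if "t \<in> {t0..t1}" "t \<notin> ?X" for t
    using eq[OF that, symmetric] assms(5,6) 
    by (simp add: tent_slope_def mult_left_le_one_le)
  ultimately show "AE t in lebesgue_on {t0..t1}. ?f t \<le> ereal (norm \<eta>)"
    by (subst AE_restrict_space_iff) (auto elim!: eventually_mono)
qed

section \<open>Tent variations of the extremal\<close>

locale smooth_extremal = smooth_lagrangian +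
  fixes t0 t1 s0 s1 :: real and x0 x1 :: "real^'n" and xb :: "real \<Rightarrow> real^'n"
  assumes I: "a < t0" "t0 < t1" "t1 < b"
    and xb: "extremal Lx Lv t0 t1 x0 x1 xb"
    and S: "s0 < s1" "{s0<..<s1} \<subseteq> {t0..t1}" "{s0<..<s1} \<inter> angular_points t0 t1 xb = {}"
begin

abbreviation "vb \<equiv> velocity t0 t1 xb"

lemma xb_KC1: "xb \<in> KC1 t0 t1"
  using xb by (simp add: extremal_def admissible_def)

text \<open>An open subset of a closed interval lies in its interior, so on
  \<open>{s0<..<s1}\<close> all derivatives are two-sided.\<close>

lemma S_interior: "{s0<..<s1} \<subseteq> {t0<..<t1}"
proof -
  have "interior {s0<..<s1} \<subseteq> interior {t0..t1}" using S(2) by (rule interior_mono)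
  then show ?thesis by simp
qed

lemma S_domain:
  assumes "t \<in> {s0<..<s1}" shows "t \<in> {a<..<b}"
  using assms S_interior I by (meson greaterThanLessThan_iff less_trans subset_iff)

lemma at_within_S:
  assumes "t \<in> {s0<..<s1}" shows "at t within {t0..t1} = at t"
  using assms S_interior by (intro at_within_interior) auto

lemma S_isCont:
  assumes "t \<in> {s0<..<s1}"
  shows "isCont xb t" "isCont vb t"
proof -
  have "t \<in> {t0..t1}" "t \<notin> angular_points t0 t1 xb" using assms S by blast+
  then have C1: "C1_point t0 t1 xb t" by (rule KC1_C1_point[OF xb_KC1])
  then show "isCont vb t" unfolding C1_point_def at_within_S[OF assms] by simp
  from C1 show "isCont xb t" unfolding C1_point_def at_within_S[OF assms]
    by (simp add: differentiable_imp_continuous_within)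
qed

lemma Euler:
  assumes "t \<in> {s0<..<s1}"
  shows "((\<lambda>s. Lv s (xb s) (vb s)) has_vector_derivative Lx t (xb t) (vb t)) (at t)"
proof -
  have "t \<in> {t0..t1} - angular_points t0 t1 xb" using assms S by blast
  then have "((\<lambda>s. Lv s (xb s) (vb s)) has_vector_derivative Lx t (xb t) (vb t)) (at t within {t0..t1})"
    using xb by (simp add: extremal_def)
  then show ?thesis unfolding at_within_S[OF assms] .
qed

text \<open>The change of the integrand on a side of the tent with slope \<open>c\<close>, where
  \<open>q\<close> is the zero of that side.\<close>

definition increment :: "real^'n \<Rightarrow> real \<Rightarrow> real \<Rightarrow> real \<Rightarrow> real" where
  "increment \<eta> c q t = L t (xb t + (c * (t - q)) *\<^sub>R \<eta>) (vb t + c *\<^sub>R \<eta>) - L t (xb t) (vb t)"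

text \<open>The increment without its first-order part, the integrand of the first
  variation.\<close>

definition remainder :: "real^'n \<Rightarrow> real \<Rightarrow> real \<Rightarrow> real \<Rightarrow> real" where
  "remainder \<eta> c q t = increment \<eta> c q t
     - (c * (t - q)) * (Lx t (xb t) (vb t) \<bullet> \<eta>) - c * (Lv t (xb t) (vb t) \<bullet> \<eta>)"

definition momentum :: "real^'n \<Rightarrow> real \<Rightarrow> real" where
  "momentum \<eta> t = Lv t (xb t) (vb t) \<bullet> \<eta>"

text \<open>By the Euler equation \<open>momentum\<close> has derivative \<open>Lx\<close> paired
  with \<open>\<eta>\<close>, so the first-order part is the exact derivative of
  \<open>c * (t - q) * momentum \<eta> t\<close> and contributes only boundary terms.\<close>

lemma increment_has_integral:
  assumes "u \<le> w" "{u..w} \<subseteq> {s0<..<s1}"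
  obtains i where "(remainder \<eta> c q has_integral i) {u..w}"
    "(increment \<eta> c q has_integral (c * (w - q) * momentum \<eta> w - c * (u - q) * momentum \<eta> u + i)) {u..w}"
proof -
  let ?G = "\<lambda>t. c * (t - q) * momentum \<eta> t"
  let ?g = "\<lambda>t. (c * (t - q)) * (Lx t (xb t) (vb t) \<bullet> \<eta>) + c * momentum \<eta> t"
  have "(?G has_vector_derivative ?g t) (at t within {u..w})" if "t \<in> {u..w}" for t
  proof -
    have "(momentum \<eta> has_real_derivative Lx t (xb t) (vb t) \<bullet> \<eta>) (at t)"
      unfolding has_real_derivative_iff_has_vector_derivative momentum_def[abs_def]
      using Euler[of t] that assms(2)
      by (intro bounded_linear.has_vector_derivative[OF bounded_linear_inner_left]) auto
    then have "(?G has_real_derivative ?g t) (at t)"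
      by (auto intro!: derivative_eq_intros)
    then show ?thesis
      by (simp add: has_real_derivative_iff_has_vector_derivative has_vector_derivative_at_within)
  qed
  from fundamental_theorem_of_calculus[OF assms(1) this]
  have g: "(?g has_integral (?G w - ?G u)) {u..w}" by blast
  have xbc: "continuous_on {u..w} xb" and vbc: "continuous_on {u..w} vb"
    using S_isCont assms(2) by (auto intro!: continuous_at_imp_continuous_on)
  have Lc: "continuous_on {u..w} (\<lambda>t. L t (y t) (z t))"
    if "continuous_on {u..w} y" "continuous_on {u..w} z" for y z
  proof -
    have "continuous_on {u..w} ((\<lambda>(t, x, v). L t x v) \<circ> (\<lambda>t. (t, y t, z t)))"
      by (intro continuous_on_compose continuous_intros that continuous_on_subset[OF L_continuous_on])
        (use S_domain assms(2) in blast)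
    then show ?thesis by (simp add: o_def)
  qed
  have "continuous_on {u..w} (increment \<eta> c q)"
    unfolding increment_def[abs_def] by (intro continuous_on_diff Lc continuous_intros xbc vbc)
  then have D: "(increment \<eta> c q has_integral integral {u..w} (increment \<eta> c q)) {u..w}"
    by (intro integrable_integral integrable_continuous_real)
  define D where "D = integral {u..w} (increment \<eta> c q)"
  note D = D[folded D_def]
  have "(remainder \<eta> c q has_integral (D - (?G w - ?G u))) {u..w}"
    using has_integral_diff[OF D g]
    by (rule has_integral_eq[rotated]) (simp add: remainder_def momentum_def)
  moreover have "(increment \<eta> c q has_integral (?G w - ?G u + (D - (?G w - ?G u)))) {u..w}"
    using D by simp
  ultimately show ?thesis by (rule that)
qed

text \<open>The boundary terms vanish at \<open>p\<close> and \<open>r\<close>, where the tent is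
  zero, and cancel at \<open>m\<close> by the balance. Only the integrals of the remainders
  survive.\<close>

lemma functional_J_tent:
  assumes order: "p < m" "m < r" "{p..r} \<subseteq> {s0<..<s1}"
    and bal: "c * (m - p) + c' * (r - m) = 0"
  obtains i j where "(remainder \<eta> c p has_integral i) {p..m}" "(remainder \<eta> c' r has_integral j) {m..r}"
    "functional_J L t0 t1 (\<lambda>t. xb t + tent p m r c c' \<eta> t) - functional_J L t0 t1 xb = i + j"
proof -
  let ?x = "\<lambda>t. xb t + tent p m r c c' \<eta> t"
  let ?f = "\<lambda>t. L t (xb t) (vb t)" and ?h = "\<lambda>t. L t (?x t) (velocity t0 t1 ?x t)"
  let ?g = "\<lambda>t. if t \<notin> {p..r} then 0 else if t < m then increment \<eta> c p t else increment \<eta> c' r t"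
  let ?N = "angular_points t0 t1 xb \<union> {p, m, r}"
  have fin: "finite ?N" using xb_KC1 by (simp add: KC1_def)
  obtain i where i: "(remainder \<eta> c p has_integral i) {p..m}"
    "(increment \<eta> c p has_integral (c * (m - p) * momentum \<eta> m - c * (p - p) * momentum \<eta> p + i)) {p..m}"
    by (rule increment_has_integral[of p m \<eta> c p]) (use order in auto)
  obtain j where j: "(remainder \<eta> c' r has_integral j) {m..r}"
    "(increment \<eta> c' r has_integral (c' * (r - r) * momentum \<eta> r - c' * (m - r) * momentum \<eta> m + j)) {m..r}"
    by (rule increment_has_integral[of m r \<eta> c' r]) (use order in auto)
  have "(?g has_integral (c * (m - p) * momentum \<eta> m - c * (p - p) * momentum \<eta> p + i)) {p..m}"
    by (rule has_integral_spike_finite[OF _ _ i(2), of "{m}"]) (use order in auto)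
  moreover have "(?g has_integral (c' * (r - r) * momentum \<eta> r - c' * (m - r) * momentum \<eta> m + j)) {m..r}"
    by (rule has_integral_spike_finite[OF _ _ j(2), of "{}"]) (use order in auto)
  ultimately have "(?g has_integral (c * (m - p) * momentum \<eta> m - c * (p - p) * momentum \<eta> p + i
      + (c' * (r - r) * momentum \<eta> r - c' * (m - r) * momentum \<eta> m + j))) {p..r}"
    using order by (intro has_integral_combine[of p m r]) auto
  moreover have "c * (m - p) * momentum \<eta> m - c * (p - p) * momentum \<eta> p + i
      + (c' * (r - r) * momentum \<eta> r - c' * (m - r) * momentum \<eta> m + j)
      = (c * (m - p) + c' * (r - m)) * momentum \<eta> m + (i + j)"
    by (simp add: algebra_simps)
  moreover have "(c * (m - p) + c' * (r - m)) * momentum \<eta> m + (i + j) = i + j"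
    using bal by simp
  ultimately have "(?g has_integral (i + j)) {p..r}" by (simp only:)
  then have g: "(?g has_integral (i + j)) {t0..t1}"
  proof (rule has_integral_on_superset)
    show "{p..r} \<subseteq> {t0..t1}" using order(3) S(2) by (rule order_trans)
  qed auto
  have "{t0..t1} \<subseteq> {a<..<b}" using I by auto
  then have "?f integrable_on {t0..t1}"
    by (intro Lagrangian_integrable I xb_KC1 continuous_on_subset[OF L_continuous_on]) auto
  then have f: "(?f has_integral functional_J L t0 t1 xb) {t0..t1}"
    unfolding functional_J_def by (rule integrable_integral)
  \<comment> \<open>The finitely many angular points and kinks, where velocities need not add, do
    not affect the integral.\<close>
  have "(?h has_integral (functional_J L t0 t1 xb + (i + j))) {t0..t1}"
  proof (rule has_integral_spike_finite[OF fin _ has_integral_add[OF f g]])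
    fix t assume t: "t \<in> {t0..t1} - ?N"
    have v: "velocity t0 t1 ?x t = vb t + tent_slope p m r c c' t *\<^sub>R \<eta>"
      by (rule velocity_add_tent[OF xb_KC1 I(2) order(1,2) t])
    show "?h t = ?f t + ?g t"
      unfolding v using t order tent_values[OF order(1,2) bal, of t \<eta>]
      by (auto simp: tent_slope_def increment_def)
  qed
  then have "functional_J L t0 t1 ?x = functional_J L t0 t1 xb + (i + j)"
    unfolding functional_J_def[of L t0 t1 ?x] by (rule integral_unique)
  with i(1) j(1) show ?thesis by (intro that) auto
qed

section \<open>Minimality among tents\<close>

text \<open>The common consequence of strong and weak minimality used below. Slopes are at most 1,
  so \<open>norm \<eta>\<close> bounds the velocity change; \<open>\<rho>\<close> bounds the scalar
  height of the tent.\<close>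

definition tent_minimal :: "real \<Rightarrow> real^'n \<Rightarrow> bool" where
  "tent_minimal \<rho> \<eta> \<longleftrightarrow> (\<forall>p m r c c'. t0 < p \<and> p < m \<and> m < r \<and> r < t1 \<and>
     c * (m - p) + c' * (r - m) = 0 \<and> \<bar>c\<bar> \<le> 1 \<and> \<bar>c'\<bar> \<le> 1 \<and> \<bar>c\<bar> * (m - p) \<le> \<rho> \<longrightarrow>
     functional_J L t0 t1 xb \<le> functional_J L t0 t1 (\<lambda>t. xb t + tent p m r c c' \<eta> t))"

lemma tent_admissible:
  assumes "t0 < p" "p < m" "m < r" "r < t1" "c * (m - p) + c' * (r - m) = 0"
  shows "(\<lambda>t. xb t + tent p m r c c' \<eta> t) \<in> admissible t0 t1 x0 x1"
  using xb assms KC1_add[OF I(2) xb_KC1 tent_KC1[OF assms(1-4)]]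
  by (simp add: extremal_def admissible_def tent_values(1)[OF assms(2,3,5)])

text \<open>Only the height of the tent has to be small, so every \<open>\<eta>\<close> is allowed,
  with \<open>\<rho>\<close> chosen after it.\<close>

lemma strong_local_min_tent_minimal:
  assumes "strong_local_min L t0 t1 x0 x1 xb"
  obtains \<rho> where "\<rho> > 0" "tent_minimal \<rho> \<eta>"
proof -
  obtain \<delta> where \<delta>: "\<delta> > 0" "\<And>x. x \<in> admissible t0 t1 x0 x1 \<Longrightarrow> C_norm t0 t1 (\<lambda>t. x t - xb t) \<le> \<delta> \<Longrightarrow>
      functional_J L t0 t1 xb \<le> functional_J L t0 t1 x"
    using assms unfolding strong_local_min_def by blast
  obtain \<rho> where \<rho>: "\<rho> > 0" "\<rho> * norm \<eta> < \<delta>" using obtain_small_multiple[OF \<delta>(1)] by blast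
  have "tent_minimal \<rho> \<eta>" unfolding tent_minimal_def
  proof (intro allI impI, elim conjE)
    fix p m r c c' assume *: "t0 < p" "p < m" "m < r" "r < t1" "c * (m - p) + c' * (r - m) = 0"
      and le: "\<bar>c\<bar> * (m - p) \<le> \<rho>"
    have "\<bar>c\<bar> * (m - p) * norm \<eta> \<le> \<rho> * norm \<eta>" using le by (rule mult_right_mono) simp
    with \<rho>(2) C_norm_tent_le[OF I(2) *(2,3,5), of xb \<eta>]
    have "C_norm t0 t1 (\<lambda>t. (xb t + tent p m r c c' \<eta> t) - xb t) \<le> \<delta>" by linarith
    then show "functional_J L t0 t1 xb \<le> functional_J L t0 t1 (\<lambda>t. xb t + tent p m r c c' \<eta> t)"
      by (rule \<delta>(2)[OF tent_admissible[OF *]])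
  qed
  with \<rho>(1) show ?thesis by (rule that)
qed

text \<open>With height and slopes at most 1, both norms of the variation are at most
  \<open>norm \<eta>\<close>; the radius of the weak minimum therefore serves as a bound on
  \<open>\<eta>\<close>.\<close>

lemma weak_local_min_tent_minimal:
  assumes "weak_local_min L t0 t1 x0 x1 xb"
  obtains \<delta> where "\<delta> > 0" "\<And>\<eta>. norm \<eta> \<le> \<delta> \<Longrightarrow> tent_minimal 1 \<eta>"
proof -
  obtain \<delta> where \<delta>: "\<delta> > 0" "\<And>x. x \<in> admissible t0 t1 x0 x1 \<Longrightarrow>
      max (ereal (C_norm t0 t1 (\<lambda>t. x t - xb t))) (Linf_norm t0 t1 (\<lambda>t. velocity t0 t1 x t - vb t)) \<le> ereal \<delta> \<Longrightarrow>
      functional_J L t0 t1 xb \<le> functional_J L t0 t1 x"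
    using assms unfolding weak_local_min_def by blast
  have "tent_minimal 1 \<eta>" if "norm \<eta> \<le> \<delta>" for \<eta> unfolding tent_minimal_def
  proof (intro allI impI, elim conjE)
    fix p m r c c' assume *: "t0 < p" "p < m" "m < r" "r < t1" "c * (m - p) + c' * (r - m) = 0"
      and c: "\<bar>c\<bar> \<le> 1" "\<bar>c'\<bar> \<le> 1" and le: "\<bar>c\<bar> * (m - p) \<le> 1"
    have "\<bar>c\<bar> * (m - p) * norm \<eta> \<le> 1 * norm \<eta>" using le by (rule mult_right_mono) simp
    with that C_norm_tent_le[OF I(2) *(2,3,5), of xb \<eta>]
    have "C_norm t0 t1 (\<lambda>t. (xb t + tent p m r c c' \<eta> t) - xb t) \<le> \<delta>" by linarith
    moreover have "Linf_norm t0 t1 (\<lambda>t. velocity t0 t1 (\<lambda>t. xb t + tent p m r c c' \<eta> t) t - vb t) \<le> ereal \<delta>"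
      using Linf_norm_velocity_tent_le[OF xb_KC1 I(2) *(2,3) c, of \<eta>] that
      by (meson ereal_less_eq(3) order_trans)
    ultimately show "functional_J L t0 t1 xb \<le> functional_J L t0 t1 (\<lambda>t. xb t + tent p m r c c' \<eta> t)"
      by (intro \<delta>(2)[OF tent_admissible[OF *]]) simp
  qed
  with \<delta>(1) show ?thesis by (rule that)
qed

section \<open>Necessary condition in degenerate directions\<close>

text \<open>On the steep side (D) removes the excess, leaving the effect of the position shift. On
  the flat side the excess is cubic in \<open>c\<close> because the quadratic form of
  \<open>Lvv\<close> vanishes along the whole curve.\<close>

lemma remainder_estimates:
  assumes \<theta>: "\<theta> \<in> {s0<..<s1}" and \<omega>: "\<omega> > 0"
    and D: "condition_D L Lv Lvv t0 t1 xb {s0<..<s1} \<eta>"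
  defines "K \<equiv> \<eta> \<bullet> (Lx \<theta> (xb \<theta>) (vb \<theta> + \<eta>) - Lx \<theta> (xb \<theta>) (vb \<theta>))"
    and "M \<equiv> \<eta> \<bullet> (Lxv \<theta> (xb \<theta>) (vb \<theta>) *v \<eta>)"
  obtains C d where "C \<ge> 0" "d > 0" "{\<theta> - d..\<theta> + d} \<subseteq> {s0<..<s1}"
    "\<And>t q. \<bar>t - \<theta>\<bar> \<le> d \<Longrightarrow> \<bar>q - \<theta>\<bar> \<le> d \<Longrightarrow> \<bar>remainder \<eta> 1 q t - K * (t - q)\<bar> \<le> \<omega> * \<bar>t - q\<bar>"
    "\<And>t q c. \<bar>t - \<theta>\<bar> \<le> d \<Longrightarrow> \<bar>q - \<theta>\<bar> \<le> d \<Longrightarrow> \<bar>c\<bar> \<le> d \<Longrightarrow>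
       \<bar>remainder \<eta> c q t - c\<^sup>2 * M * (t - q)\<bar> \<le> \<omega> * c\<^sup>2 * \<bar>t - q\<bar> + C * \<bar>c\<bar> ^ 3"
proof -
  note \<theta>' = S_domain[OF \<theta>]
  obtain d1 where d1: "d1 > 0" "\<And>t x v k. \<bar>t - \<theta>\<bar> < d1 \<Longrightarrow> dist x (xb \<theta>) < d1 \<Longrightarrow> dist v (vb \<theta>) < d1 \<Longrightarrow> \<bar>k\<bar> < d1 \<Longrightarrow>
      \<bar>L t (x + k *\<^sub>R \<eta>) (v + \<eta>) - L t x (v + \<eta>) - k * (Lx t x v \<bullet> \<eta>) - k * K\<bar> \<le> \<omega> * \<bar>k\<bar>"
    by (rule shift_x_estimate[OF \<theta>' \<omega>, of "xb \<theta>" "vb \<theta>" \<eta>, folded K_def], rule that)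
  obtain d2 where d2: "d2 > 0" "\<And>t x v k c. \<bar>t - \<theta>\<bar> < d2 \<Longrightarrow> dist x (xb \<theta>) < d2 \<Longrightarrow> dist v (vb \<theta>) < d2 \<Longrightarrow>
      \<bar>k\<bar> < d2 \<Longrightarrow> \<bar>c\<bar> < d2 \<Longrightarrow>
      \<bar>L t (x + k *\<^sub>R (c *\<^sub>R \<eta>)) (v + c *\<^sub>R \<eta>) - L t x (v + c *\<^sub>R \<eta>) - k * (Lx t x v \<bullet> (c *\<^sub>R \<eta>))
        - k * (c\<^sup>2 * M)\<bar> \<le> \<omega> * c\<^sup>2 * \<bar>k\<bar>"
    by (rule small_shift_x_estimate[OF \<theta>' \<omega>, of "xb \<theta>" "vb \<theta>" \<eta>, folded M_def], rule that)
  obtain C d3 where d3: "d3 > 0" "C \<ge> 0" "\<And>t x v c. \<bar>t - \<theta>\<bar> < d3 \<Longrightarrow> dist x (xb \<theta>) < d3 \<Longrightarrow> dist v (vb \<theta>) < d3 \<Longrightarrow>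
      \<bar>c\<bar> < d3 \<Longrightarrow> \<eta> \<bullet> (Lvv t x v *v \<eta>) = 0 \<Longrightarrow>
      \<bar>L t x (v + c *\<^sub>R \<eta>) - L t x v - c * (Lv t x v \<bullet> \<eta>)\<bar> \<le> C * \<bar>c\<bar> ^ 3"
    by (rule degenerate_excess_estimate[OF \<theta>', of "xb \<theta>" "vb \<theta>" \<eta>], rule that)
  define e where "e = min d1 (min d2 d3)"
  have e: "e > 0" "e \<le> d1" "e \<le> d2" "e \<le> d3" using d1 d2 d3 by (auto simp: e_def)
  obtain r1 where r1: "r1 > 0" "\<And>t. dist t \<theta> < r1 \<Longrightarrow> dist (xb t) (xb \<theta>) < e"
    using S_isCont(1)[OF \<theta>] e(1) unfolding continuous_at_eps_delta by blast
  obtain r2 where r2: "r2 > 0" "\<And>t. dist t \<theta> < r2 \<Longrightarrow> dist (vb t) (vb \<theta>) < e"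
    using S_isCont(2)[OF \<theta>] e(1) unfolding continuous_at_eps_delta by blast
  \<comment> \<open>A third of \<open>e\<close> ensures \<open>\<bar>t - q\<bar> < e\<close> for two
    points within \<open>d\<close> of \<open>\<theta>\<close>; the halves turn the open conditions
    into ones valid on a closed interval.\<close>
  define d where "d = min (min (r1 / 2) (r2 / 2)) (min (e / 3) (min ((\<theta> - s0) / 2) ((s1 - \<theta>) / 2)))"
  have d: "d > 0" "d \<le> r1 / 2" "d \<le> r2 / 2" "d \<le> e / 3" "d \<le> (\<theta> - s0) / 2" "d \<le> (s1 - \<theta>) / 2"
  proof -
    show "d > 0" using r1(1) r2(1) e(1) \<theta> by (auto simp: d_def)
  qed (unfold d_def, linarith+)
  have sub: "{\<theta> - d..\<theta> + d} \<subseteq> {s0<..<s1}" using d \<theta> by auto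
  have near: "\<bar>t - \<theta>\<bar> < e" "dist (xb t) (xb \<theta>) < e" "dist (vb t) (vb \<theta>) < e" "t \<in> {s0<..<s1}"
    if "\<bar>t - \<theta>\<bar> \<le> d" for t
  proof -
    show "\<bar>t - \<theta>\<bar> < e" using that d e(1) by linarith
    show "dist (xb t) (xb \<theta>) < e" using that d r1 by (intro r1(2)) (simp add: dist_real_def)
    show "dist (vb t) (vb \<theta>) < e" using that d r2 by (intro r2(2)) (simp add: dist_real_def)
    have "t \<in> {\<theta> - d..\<theta> + d}" using that by (auto simp: abs_le_iff)
    then show "t \<in> {s0<..<s1}" using sub by blast
  qed
  show ?thesis
  proof (rule that[OF d3(2) d(1) sub])
    fix t q assume *: "\<bar>t - \<theta>\<bar> \<le> d" "\<bar>q - \<theta>\<bar> \<le> d"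
    note n = near[OF *(1)]
    have k: "\<bar>t - q\<bar> < e" using * d e(1) by linarith
    have "excess L Lv t0 t1 xb t \<eta> = 0" using D n(4) by (simp add: condition_D_def)
    then have "remainder \<eta> 1 q t - K * (t - q) = L t (xb t + (t - q) *\<^sub>R \<eta>) (vb t + \<eta>) - L t (xb t) (vb t + \<eta>)
        - (t - q) * (Lx t (xb t) (vb t) \<bullet> \<eta>) - (t - q) * K"
      by (simp add: remainder_def increment_def excess_def)
    then show "\<bar>remainder \<eta> 1 q t - K * (t - q)\<bar> \<le> \<omega> * \<bar>t - q\<bar>"
      using d1(2)[of t "xb t" "vb t" "t - q"] n k e by (simp only:)
    fix c assume c: "\<bar>c\<bar> \<le> d"
    then have c': "\<bar>c\<bar> < e" using d e(1) by linarith
    let ?A = "L t (xb t + (t - q) *\<^sub>R (c *\<^sub>R \<eta>)) (vb t + c *\<^sub>R \<eta>) - L t (xb t) (vb t + c *\<^sub>R \<eta>)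
        - (t - q) * (Lx t (xb t) (vb t) \<bullet> (c *\<^sub>R \<eta>)) - (t - q) * (c\<^sup>2 * M)"
    let ?B = "L t (xb t) (vb t + c *\<^sub>R \<eta>) - L t (xb t) (vb t) - c * (Lv t (xb t) (vb t) \<bullet> \<eta>)"
    have "\<bar>?A\<bar> \<le> \<omega> * c\<^sup>2 * \<bar>t - q\<bar>"
      using d2(2)[of t "xb t" "vb t" "t - q" c] n k c' e by simp
    moreover have "\<bar>?B\<bar> \<le> C * \<bar>c\<bar> ^ 3"
      using d3(3)[of t "xb t" "vb t" c] n c' e D by (simp add: condition_D_def)
    moreover have "remainder \<eta> c q t - c\<^sup>2 * M * (t - q) = ?A + ?B"
      by (simp add: remainder_def increment_def mult.commute mult.left_commute)
    ultimately show "\<bar>remainder \<eta> c q t - c\<^sup>2 * M * (t - q)\<bar> \<le> \<omega> * c\<^sup>2 * \<bar>t - q\<bar> + C * \<bar>c\<bar> ^ 3"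
      by linarith
  qed
qed

text \<open>The expression in (C) at \<open>\<theta>\<close> is \<open>K - M\<close>. A tent
  starting at \<open>\<theta>\<close> bounds it from below and one ending there from above, both up
  to a multiple of an arbitrary \<open>\<omega>\<close>.\<close>

lemma condition_C_if_tent_minimal:
  assumes min: "tent_minimal \<rho> \<eta>" "\<rho> > 0"
    and D: "condition_D L Lv Lvv t0 t1 xb {s0<..<s1} \<eta>"
  shows "condition_C Lx Lxv t0 t1 xb {s0<..<s1} \<eta>"
  unfolding condition_C_def
proof
  fix \<theta> assume \<theta>: "\<theta> \<in> {s0<..<s1}"
  define K where "K = \<eta> \<bullet> (Lx \<theta> (xb \<theta>) (vb \<theta> + \<eta>) - Lx \<theta> (xb \<theta>) (vb \<theta>))"
  define M where "M = \<eta> \<bullet> (Lxv \<theta> (xb \<theta>) (vb \<theta>) *v \<eta>)"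
  have "\<bar>K - M\<bar> \<le> 4 * \<omega>" if \<omega>: "\<omega> > 0" for \<omega>
  proof -
    obtain C d where C: "C \<ge> 0" and d: "d > 0" "{\<theta> - d..\<theta> + d} \<subseteq> {s0<..<s1}"
      and RA: "\<And>t q. \<bar>t - \<theta>\<bar> \<le> d \<Longrightarrow> \<bar>q - \<theta>\<bar> \<le> d \<Longrightarrow> \<bar>remainder \<eta> 1 q t - K * (t - q)\<bar> \<le> \<omega> * \<bar>t - q\<bar>"
      and RB: "\<And>t q c. \<bar>t - \<theta>\<bar> \<le> d \<Longrightarrow> \<bar>q - \<theta>\<bar> \<le> d \<Longrightarrow> \<bar>c\<bar> \<le> d \<Longrightarrow>
       \<bar>remainder \<eta> c q t - c\<^sup>2 * M * (t - q)\<bar> \<le> \<omega> * c\<^sup>2 * \<bar>t - q\<bar> + C * \<bar>c\<bar> ^ 3"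
      using remainder_estimates[OF \<theta> \<omega> D] unfolding K_def M_def by blast
    obtain e where e: "e > 0" "e * C < \<omega>" using obtain_small_multiple[OF \<omega>] by blast
    \<comment> \<open>The bound 1 orders the powers of \<open>\<beta>\<close>, \<open>e\<close>
      gives \<open>C * \<beta> \<le> \<omega>\<close>, \<open>d / 2\<close> keeps the total length
      \<open>\<beta> ^ 3 + \<beta>\<close> within \<open>d\<close>, and \<open>\<rho>\<close>
      dominates the height \<open>\<beta> ^ 3\<close>.\<close>
    define \<beta> where "\<beta> = min (min 1 e) (min (d / 2) \<rho>)"
    have \<beta>: "\<beta> > 0" "\<beta> \<le> 1" "\<beta> \<le> e" "\<beta> \<le> d / 2" "\<beta> \<le> \<rho>"
      using e(1) d(1) min(2) by (auto simp: \<beta>_def)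
    have pow: "\<beta> ^ 3 \<le> \<beta>" "\<beta>\<^sup>2 \<le> \<beta>" "\<beta> ^ 3 > 0"
      using power_decreasing[of 1 3 \<beta>] power_decreasing[of 1 2 \<beta>] \<beta>(1,2) by auto
    have C\<beta>: "C * \<beta> \<le> \<omega>" using mult_right_mono[OF \<beta>(3) C] e(2) by (simp add: mult.commute)
    have c2: "(- \<beta>\<^sup>2)\<^sup>2 = \<beta> ^ 4" "\<bar>- \<beta>\<^sup>2\<bar> = \<beta>\<^sup>2" by (simp_all flip: power_mult)
    have in_T: "t0 < t \<and> t < t1" if "\<bar>t - \<theta>\<bar> \<le> d" for t
    proof -
      have "t \<in> {\<theta> - d..\<theta> + d}" using that by (auto simp: abs_le_iff)
      then have "t \<in> {t0<..<t1}" using d(2) S_interior by blast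
      then show ?thesis by simp
    qed
    have "K - M \<ge> - 4 * \<omega>"
    proof -
      let ?m = "\<theta> + \<beta> ^ 3" and ?r = "\<theta> + \<beta> ^ 3 + \<beta>"
      have bal: "1 * (?m - \<theta>) + (- \<beta>\<^sup>2) * (?r - ?m) = 0" by (simp add: power3_eq_cube power2_eq_square)
      have sub: "{\<theta>..?r} \<subseteq> {s0<..<s1}" using d(2) \<beta> pow by fastforce
      obtain i j where i: "(remainder \<eta> 1 \<theta> has_integral i) {\<theta>..?m}"
        and j: "(remainder \<eta> (- \<beta>\<^sup>2) ?r has_integral j) {?m..?r}"
        and J: "functional_J L t0 t1 (\<lambda>t. xb t + tent \<theta> ?m ?r 1 (- \<beta>\<^sup>2) \<eta> t) - functional_J L t0 t1 xb = i + j"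
        using functional_J_tent[of \<theta> ?m ?r 1 "- \<beta>\<^sup>2" \<eta>] \<beta>(1) pow(3) sub bal by auto
      have "functional_J L t0 t1 xb \<le> functional_J L t0 t1 (\<lambda>t. xb t + tent \<theta> ?m ?r 1 (- \<beta>\<^sup>2) \<eta> t)"
        using min(1) bal in_T[of \<theta>] in_T[of ?r] d(1) \<beta> pow
        unfolding tent_minimal_def by (elim allE impE) auto
      then have "0 \<le> i + j" using J by linarith
      moreover have "\<bar>i - K * ((?m - \<theta>)\<^sup>2 / 2)\<bar> \<le> \<omega> * ((?m - \<theta>)\<^sup>2 / 2) + 0 * (?m - \<theta>)"
      proof (rule integral_near_ramp_left[OF i])
        fix t assume "t \<in> {\<theta>..?m}"
        then show "\<bar>remainder \<eta> 1 \<theta> t - K * (t - \<theta>)\<bar> \<le> \<omega> * (t - \<theta>) + 0"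
          using RA[of t \<theta>] \<beta> pow d(1) by simp
      qed (use pow in simp)
      \<comment> \<open>Here \<open>c\<close> is \<open>- \<beta>\<^sup>2\<close>: its square gives
        \<open>\<beta> ^ 4\<close>, its cube the uniform error of order \<open>\<beta> ^ 6\<close>,
        which the length \<open>\<beta>\<close> raises to order 7.\<close>
      moreover have "\<bar>j + \<beta> ^ 4 * M * ((?r - ?m)\<^sup>2 / 2)\<bar> \<le> \<omega> * \<beta> ^ 4 * ((?r - ?m)\<^sup>2 / 2) + C * (\<beta>\<^sup>2) ^ 3 * (?r - ?m)"
      proof (rule integral_near_ramp_right[OF j])
        fix t assume "t \<in> {?m..?r}"
        then show "\<bar>remainder \<eta> (- \<beta>\<^sup>2) ?r t - \<beta> ^ 4 * M * (t - ?r)\<bar> \<le> \<omega> * \<beta> ^ 4 * (?r - t) + C * (\<beta>\<^sup>2) ^ 3"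
          using RB[of t ?r "- \<beta>\<^sup>2"] \<beta> pow d(1) unfolding c2 by simp
      qed (use \<beta> in simp)
      moreover have "(?m - \<theta>)\<^sup>2 = \<beta> ^ 6" "\<beta> ^ 4 * M * ((?r - ?m)\<^sup>2 / 2) = \<beta> ^ 6 * M / 2"
        "\<omega> * \<beta> ^ 4 * ((?r - ?m)\<^sup>2 / 2) = \<beta> ^ 6 * \<omega> / 2" "C * (\<beta>\<^sup>2) ^ 3 * (?r - ?m) = \<beta> ^ 6 * (C * \<beta>)"
        by (simp_all add: power_mult[symmetric] flip: power_add)
      moreover have "\<beta> ^ 6 * (K / 2 - M / 2 + \<omega> + C * \<beta>)
          = K * (\<beta> ^ 6 / 2) + \<omega> * (\<beta> ^ 6 / 2) - \<beta> ^ 6 * M / 2 + \<beta> ^ 6 * \<omega> / 2 + \<beta> ^ 6 * (C * \<beta>)"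
        by (simp add: field_simps)
      ultimately have "0 \<le> \<beta> ^ 6 * (K / 2 - M / 2 + \<omega> + C * \<beta>)"
        by (simp only: abs_le_iff) linarith
      then have "0 \<le> K / 2 - M / 2 + \<omega> + C * \<beta>"
        using \<beta>(1) by (simp add: zero_le_mult_iff)
      \<comment> \<open>The errors total at most \<open>2 * \<omega>\<close> against
        \<open>(K - M) / 2\<close>, hence the constant 4.\<close>
      then show ?thesis using C\<beta> by linarith
    qed
    moreover have "K - M \<le> 4 * \<omega>"
    proof -
      \<comment> \<open>The mirrored order of sides makes the tent negative with slope 1 just before
        \<open>\<theta>\<close>, so the contributions of \<open>K\<close> and \<open>M\<close> both
        change sign.\<close>
      let ?m = "\<theta> - \<beta> ^ 3" and ?p = "\<theta> - \<beta> ^ 3 - \<beta>"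
      have bal: "(- \<beta>\<^sup>2) * (?m - ?p) + 1 * (\<theta> - ?m) = 0" by (simp add: power3_eq_cube power2_eq_square)
      have sub: "{?p..\<theta>} \<subseteq> {s0<..<s1}" using d(2) \<beta> pow by fastforce
      obtain i j where i: "(remainder \<eta> (- \<beta>\<^sup>2) ?p has_integral i) {?p..?m}"
        and j: "(remainder \<eta> 1 \<theta> has_integral j) {?m..\<theta>}"
        and J: "functional_J L t0 t1 (\<lambda>t. xb t + tent ?p ?m \<theta> (- \<beta>\<^sup>2) 1 \<eta> t) - functional_J L t0 t1 xb = i + j"
        using functional_J_tent[of ?p ?m \<theta> "- \<beta>\<^sup>2" 1 \<eta>] \<beta>(1) pow(3) sub bal by auto
      have "\<bar>- \<beta>\<^sup>2\<bar> * (?m - ?p) = \<beta> ^ 3" by (simp add: power3_eq_cube power2_eq_square)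
      then have "functional_J L t0 t1 xb \<le> functional_J L t0 t1 (\<lambda>t. xb t + tent ?p ?m \<theta> (- \<beta>\<^sup>2) 1 \<eta> t)"
        using min(1) bal in_T[of \<theta>] in_T[of ?p] d(1) \<beta> pow
        unfolding tent_minimal_def by (elim allE impE) auto
      then have "0 \<le> i + j" using J by linarith
      moreover have "\<bar>j + K * ((\<theta> - ?m)\<^sup>2 / 2)\<bar> \<le> \<omega> * ((\<theta> - ?m)\<^sup>2 / 2) + 0 * (\<theta> - ?m)"
      proof (rule integral_near_ramp_right[OF j])
        fix t assume "t \<in> {?m..\<theta>}"
        then show "\<bar>remainder \<eta> 1 \<theta> t - K * (t - \<theta>)\<bar> \<le> \<omega> * (\<theta> - t) + 0"
          using RA[of t \<theta>] \<beta> pow d(1) by simp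
      qed (use pow in simp)
      moreover have "\<bar>i - \<beta> ^ 4 * M * ((?m - ?p)\<^sup>2 / 2)\<bar> \<le> \<omega> * \<beta> ^ 4 * ((?m - ?p)\<^sup>2 / 2) + C * (\<beta>\<^sup>2) ^ 3 * (?m - ?p)"
      proof (rule integral_near_ramp_left[OF i])
        fix t assume "t \<in> {?p..?m}"
        then show "\<bar>remainder \<eta> (- \<beta>\<^sup>2) ?p t - \<beta> ^ 4 * M * (t - ?p)\<bar> \<le> \<omega> * \<beta> ^ 4 * (t - ?p) + C * (\<beta>\<^sup>2) ^ 3"
          using RB[of t ?p "- \<beta>\<^sup>2"] \<beta> pow d(1) unfolding c2 by simp
      qed (use \<beta> in simp)
      moreover have "(\<theta> - ?m)\<^sup>2 = \<beta> ^ 6" "\<beta> ^ 4 * M * ((?m - ?p)\<^sup>2 / 2) = \<beta> ^ 6 * M / 2"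
        "\<omega> * \<beta> ^ 4 * ((?m - ?p)\<^sup>2 / 2) = \<beta> ^ 6 * \<omega> / 2" "C * (\<beta>\<^sup>2) ^ 3 * (?m - ?p) = \<beta> ^ 6 * (C * \<beta>)"
        by (simp_all add: power_mult[symmetric] flip: power_add)
      moreover have "\<beta> ^ 6 * (M / 2 - K / 2 + \<omega> + C * \<beta>)
          = \<beta> ^ 6 * M / 2 + \<beta> ^ 6 * \<omega> / 2 - K * (\<beta> ^ 6 / 2) + \<omega> * (\<beta> ^ 6 / 2) + \<beta> ^ 6 * (C * \<beta>)"
        by (simp add: field_simps)
      ultimately have "0 \<le> \<beta> ^ 6 * (M / 2 - K / 2 + \<omega> + C * \<beta>)"
        by (simp only: abs_le_iff) linarith
      then have "0 \<le> M / 2 - K / 2 + \<omega> + C * \<beta>"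
        using \<beta>(1) by (simp add: zero_le_mult_iff)
      then show ?thesis using C\<beta> by linarith
    qed
    ultimately show ?thesis by linarith
  qed
  \<comment> \<open>A nonzero difference would satisfy
    \<open>\<bar>K - M\<bar> \<le> \<bar>K - M\<bar> / 2\<close>.\<close>
  from this[of "\<bar>K - M\<bar> / 8"] have "K - M = 0" by (cases "\<bar>K - M\<bar> > 0") auto
  then show "\<eta> \<bullet> (Lx \<theta> (xb \<theta>) (vb \<theta> + \<eta>) - Lx \<theta> (xb \<theta>) (vb \<theta>) - Lxv \<theta> (xb \<theta>) (vb \<theta>) *v \<eta>) = 0"
    by (simp add: K_def M_def inner_diff_right)
qed

end

theorem theorem4p3:
  fixes L :: "real \<Rightarrow> real^'n \<Rightarrow> real^'n \<Rightarrow> real"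
    and Lt :: "real \<Rightarrow> real^'n \<Rightarrow> real^'n \<Rightarrow> real"
    and Lx Lv :: "real \<Rightarrow> real^'n \<Rightarrow> real^'n \<Rightarrow> real^'n"
    and Lxx Lxv Lvv :: "real \<Rightarrow> real^'n \<Rightarrow> real^'n \<Rightarrow> real^'n^'n"
    and Lvvv :: "real \<Rightarrow> real^'n \<Rightarrow> real^'n \<Rightarrow> (real^'n) \<Rightarrow>\<^sub>L (real^'n^'n)"
    and a b t0 t1 s0 s1 :: real
    and x0 x1 :: "real^'n"
    and xb :: "real \<Rightarrow> real^'n"
  assumes I: "a < t0" "t0 < t1" "t1 < b"
    and L_deriv: "\<And>t x v. t \<in> {a<..<b} \<Longrightarrow>
          ((\<lambda>(t, x, v). L t x v) has_derivative
             (\<lambda>(dt, dx, dv). Lt t x v * dt + Lx t x v \<bullet> dx + Lv t x v \<bullet> dv)) (at (t, x, v))"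
    and Lt_cont: "continuous_on ({a<..<b} \<times> UNIV \<times> UNIV) (\<lambda>(t, x, v). Lt t x v)"
    and Lx_cont: "continuous_on ({a<..<b} \<times> UNIV \<times> UNIV) (\<lambda>(t, x, v). Lx t x v)"
    and Lv_cont: "continuous_on ({a<..<b} \<times> UNIV \<times> UNIV) (\<lambda>(t, x, v). Lv t x v)"
    and Lxx_deriv: "\<And>t x v. t \<in> {a<..<b} \<Longrightarrow>
          ((\<lambda>y. Lx t y v) has_derivative (\<lambda>dx. Lxx t x v *v dx)) (at x)"
    and Lxv_deriv: "\<And>t x v. t \<in> {a<..<b} \<Longrightarrow>
          ((\<lambda>w. Lx t x w) has_derivative (\<lambda>dv. Lxv t x v *v dv)) (at v)"
    and Lvv_deriv: "\<And>t x v. t \<in> {a<..<b} \<Longrightarrow>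
          ((\<lambda>w. Lv t x w) has_derivative (\<lambda>dv. Lvv t x v *v dv)) (at v)"
    and Lvvv_deriv: "\<And>t x v. t \<in> {a<..<b} \<Longrightarrow>
          ((\<lambda>w. Lvv t x w) has_derivative blinfun_apply (Lvvv t x v)) (at v)"
    and Lxx_cont: "continuous_on ({a<..<b} \<times> UNIV \<times> UNIV) (\<lambda>(t, x, v). Lxx t x v)"
    and Lxv_cont: "continuous_on ({a<..<b} \<times> UNIV \<times> UNIV) (\<lambda>(t, x, v). Lxv t x v)"
    and Lvv_cont: "continuous_on ({a<..<b} \<times> UNIV \<times> UNIV) (\<lambda>(t, x, v). Lvv t x v)"
    and Lvvv_cont: "continuous_on ({a<..<b} \<times> UNIV \<times> UNIV) (\<lambda>(t, x, v). Lvvv t x v)"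
    and xb: "extremal Lx Lv t0 t1 x0 x1 xb"
    and S: "s0 < s1" "{s0<..<s1} \<subseteq> {t0..t1}" "{s0<..<s1} \<inter> angular_points t0 t1 xb = {}"
  shows "(strong_local_min L t0 t1 x0 x1 xb \<longrightarrow>
            (\<forall>\<eta>. \<eta> \<noteq> 0 \<longrightarrow> condition_D L Lv Lvv t0 t1 xb {s0<..<s1} \<eta> \<longrightarrow>
                  condition_C Lx Lxv t0 t1 xb {s0<..<s1} \<eta>)) \<and>
         (weak_local_min L t0 t1 x0 x1 xb \<longrightarrow>
            (\<exists>\<delta>>0. \<forall>\<eta> \<in> cball 0 \<delta>. condition_D L Lv Lvv t0 t1 xb {s0<..<s1} \<eta> \<longrightarrow>
                  condition_C Lx Lxv t0 t1 xb {s0<..<s1} \<eta>))"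
proof -
  interpret smooth_extremal L Lt Lx Lv Lxx Lxv Lvv Lvvv a b t0 t1 s0 s1 x0 x1 xb
    by unfold_locales (fact assms)+
  show ?thesis
  proof (intro conjI impI allI)
    fix \<eta> :: "real^'n"
    assume min: "strong_local_min L t0 t1 x0 x1 xb" and D: "condition_D L Lv Lvv t0 t1 xb {s0<..<s1} \<eta>"
    obtain \<rho> where "\<rho> > 0" "tent_minimal \<rho> \<eta>"
      using strong_local_min_tent_minimal[OF min] .
    then show "condition_C Lx Lxv t0 t1 xb {s0<..<s1} \<eta>"
      using condition_C_if_tent_minimal D by blast
  next
    assume min: "weak_local_min L t0 t1 x0 x1 xb"
    \<comment> \<open>This radius depends only on the minimum and not on \<open>\<eta>\<close>,
      which gives the uniform ball in (ii).\<close>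
    obtain \<delta> where "\<delta> > 0" "\<And>\<eta>. norm \<eta> \<le> \<delta> \<Longrightarrow> tent_minimal 1 \<eta>"
      by (rule weak_local_min_tent_minimal[OF min], rule that)
    then show "\<exists>\<delta>>0. \<forall>\<eta>\<in>cball 0 \<delta>. condition_D L Lv Lvv t0 t1 xb {s0<..<s1} \<eta> \<longrightarrow>
        condition_C Lx Lxv t0 t1 xb {s0<..<s1} \<eta>"
      using condition_C_if_tent_minimal[of 1] by (intro exI[of _ \<delta>]) (auto simp: dist_norm)
  qed
qed

end
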